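(* Let $H_3$ be the discrete Heisenberg group, with generating set $S = \{(0,0,0),(1,0,0),(0,1,0),(-1,0,0),(0,-1,0)\}$. Then every $S$-horoball in $H_3$ is $S$-connected.
   Context: $H_3$ is the set of $(a,b,c)\in\mathbb{Z}^3$ such that $2\mid c\iff 2\mid ab$, with product $(a,b,c)(a',b',c') = (a+a',b+b',c+c'+(ab'-a'b))$. For a group $G$ with finite symmetric generating set $S\ni e_G$, $|g|_S$ is the minimal $\ell\ge0$ such that $g$ is a product of $\ell$ elements of $S$, $d_S(g,h) = |g^{-1}h|_S$, and $B_{S,r}(g) = \{h : d_S(g,h)\le r\}$. Subsets of $G$ carry the product (Cantor) topology of $\{0,1\}^G$: $P_i\to P$ means that for each $g\in G$, $g\in P_i\iff g\in P$ for all large $i$. An $S$-horoball is a set $P\subset G$ with $P\neq\emptyset, G$ such that $P = \lim_i B_{S,n_i}(g_i)$ for some $g_i\in G$, $n_i\in\mathbb{N}$ with $n_i\to\infty$. A set $A\subset G$ is $S$-connected if any two elements $g,g'\in A$ are joined by a finite sequence $g = g_0,g_1,\dots,g_k = g'$ in $A$ with $g_{i+1}\in g_iS$ for all $0\le i<k$. *)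

theory Defs
  imports Complex_Main "HOL-Algebra.Coset"
begin

text \<open>
  Word metrics are meant for a group \<open>G\<close> with a finite symmetric generating set \<open>S\<close> containing the
  identity; only then is the minimum below attained for every element of the carrier.
\<close>

definition word_length :: "('a, 'b) monoid_scheme \<Rightarrow> 'a set \<Rightarrow> 'a \<Rightarrow> nat" where
  "word_length G S g =
     (LEAST l. \<exists>xs. length xs = l \<and> set xs \<subseteq> S \<and> foldr (\<otimes>\<^bsub>G\<^esub>) xs \<one>\<^bsub>G\<^esub> = g)"

definition word_dist :: "('a, 'b) monoid_scheme \<Rightarrow> 'a set \<Rightarrow> 'a \<Rightarrow> 'a \<Rightarrow> nat" where
  "word_dist G S g h = word_length G S (inv\<^bsub>G\<^esub> g \<otimes>\<^bsub>G\<^esub> h)"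

definition word_ball :: "('a, 'b) monoid_scheme \<Rightarrow> 'a set \<Rightarrow> nat \<Rightarrow> 'a \<Rightarrow> 'a set" where
  "word_ball G S r g = {h \<in> carrier G. word_dist G S g h \<le> r}"

text \<open>Convergence in the product topology on the subsets of the carrier.\<close>

definition subset_converges ::
    "('a, 'b) monoid_scheme \<Rightarrow> (nat \<Rightarrow> 'a set) \<Rightarrow> 'a set \<Rightarrow> bool" where
  "subset_converges G Q P \<longleftrightarrow>
     (\<forall>g\<in>carrier G. \<forall>\<^sub>F i in sequentially. g \<in> Q i \<longleftrightarrow> g \<in> P)"

definition horoball :: "('a, 'b) monoid_scheme \<Rightarrow> 'a set \<Rightarrow> 'a set \<Rightarrow> bool" where
  "horoball G S P \<longleftrightarrow>
     P \<subseteq> carrier G \<and> P \<noteq> {} \<and> P \<noteq> carrier G \<and>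
     (\<exists>(g :: nat \<Rightarrow> 'a) (n :: nat \<Rightarrow> nat).
        (\<forall>i. g i \<in> carrier G) \<and>
        filterlim n at_top sequentially \<and>
        subset_converges G (\<lambda>i. word_ball G S (n i) (g i)) P)"

definition gen_connected :: "('a, 'b) monoid_scheme \<Rightarrow> 'a set \<Rightarrow> 'a set \<Rightarrow> bool" where
  "gen_connected G S A \<longleftrightarrow>
     (\<forall>g\<in>A. \<forall>g'\<in>A. \<exists>(k :: nat) (p :: nat \<Rightarrow> 'a).
        p 0 = g \<and> p k = g' \<and> (\<forall>i\<le>k. p i \<in> A) \<and>
        (\<forall>i<k. p (Suc i) \<in> p i <#\<^bsub>G\<^esub> S))"

definition heisenberg :: "(int \<times> int \<times> int) monoid" where
  "heisenberg =
     \<lparr>carrier = {(a, b, c). 2 dvd c \<longleftrightarrow> 2 dvd a * b},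
      mult = (\<lambda>(a, b, c) (a', b', c'). (a + a', b + b', c + c' + (a * b' - a' * b))),
      one = (0, 0, 0)\<rparr>"

definition heisenberg_gens :: "(int \<times> int \<times> int) set" where
  "heisenberg_gens = {(0, 0, 0), (1, 0, 0), (0, 1, 0), (-1, 0, 0), (0, -1, 0)}"

lemma group_heisenberg: "group heisenberg"
proof (rule groupI)
  fix x assume "x \<in> carrier heisenberg"
  then show "\<exists>y\<in>carrier heisenberg. y \<otimes>\<^bsub>heisenberg\<^esub> x = \<one>\<^bsub>heisenberg\<^esub>"
    by (intro bexI[of _ "case x of (a, b, c) \<Rightarrow> (-a, -b, -c)"])
       (auto simp: heisenberg_def split: prod.splits)
qed (auto simp: heisenberg_def algebra_simps)

lemma inv_heisenberg:
  assumes "(a, b, c) \<in> carrier heisenberg"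
  shows "inv\<^bsub>heisenberg\<^esub> (a, b, c) = (-a, -b, -c)"
  by (rule group.inv_equality[OF group_heisenberg])
     (use assms in \<open>auto simp: heisenberg_def\<close>)

lemma finite_heisenberg_gens: "finite heisenberg_gens"
  by (simp add: heisenberg_gens_def)

lemma one_in_heisenberg_gens: "\<one>\<^bsub>heisenberg\<^esub> \<in> heisenberg_gens"
  by (simp add: heisenberg_gens_def heisenberg_def)

lemma heisenberg_gens_subset: "heisenberg_gens \<subseteq> carrier heisenberg"
  by (auto simp: heisenberg_gens_def heisenberg_def)

lemma heisenberg_gens_symmetric:
  assumes "s \<in> heisenberg_gens"
  shows "inv\<^bsub>heisenberg\<^esub> s \<in> heisenberg_gens"
proof -
  obtain a b c where s: "s = (a, b, c)" by (cases s)
  have "inv\<^bsub>heisenberg\<^esub> s = (-a, -b, -c)"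
    using assms heisenberg_gens_subset s inv_heisenberg by auto
  then show ?thesis using assms s by (auto simp: heisenberg_gens_def)
qed

lemma heisenberg_gens_generate:
  assumes "g \<in> carrier heisenberg"
  shows "\<exists>xs. set xs \<subseteq> heisenberg_gens \<and> foldr (\<otimes>\<^bsub>heisenberg\<^esub>) xs \<one>\<^bsub>heisenberg\<^esub> = g"
    (is "?W g")
proof -
  have m: "(a, b, c) \<otimes>\<^bsub>heisenberg\<^esub> (a', b', c') =
      (a + a', b + b', c + c' + (a * b' - a' * b))" for a b c a' b' c'
    by (simp add: heisenberg_def)
  have step: "?W (s \<otimes>\<^bsub>heisenberg\<^esub> h)" if "s \<in> heisenberg_gens" "?W h" for s h
  proof -
    from that(2) obtain xs where "set xs \<subseteq> heisenberg_gens"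
      "foldr (\<otimes>\<^bsub>heisenberg\<^esub>) xs \<one>\<^bsub>heisenberg\<^esub> = h" by blast
    with that(1) show ?thesis by (intro exI[of _ "s # xs"]) simp
  qed
  have gens: "(1, 0, 0) \<in> heisenberg_gens" "(-1, 0, 0) \<in> heisenberg_gens"
    "(0, 1, 0) \<in> heisenberg_gens" "(0, -1, 0) \<in> heisenberg_gens"
    by (simp_all add: heisenberg_gens_def)
  have xp: "?W (a + 1, b, c + b)" if "?W (a, b, c)" for a b c
    using step[OF gens(1) that] by (simp add: m add.commute)
  have xm: "?W (a - 1, b, c - b)" if "?W (a, b, c)" for a b c
    using step[OF gens(2) that] by (simp add: m)
  have yp: "?W (a, b + 1, c - a)" if "?W (a, b, c)" for a b c
    using step[OF gens(3) that] by (simp add: m add.commute)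
  have ym: "?W (a, b - 1, c + a)" if "?W (a, b, c)" for a b c
    using step[OF gens(4) that] by (simp add: m)
  have zp: "?W (a, b, c + 2)" if "?W (a, b, c)" for a b c
    using xp[OF yp[OF xm[OF ym[OF that]]]] by (simp add: algebra_simps)
  have zm: "?W (a, b, c - 2)" if "?W (a, b, c)" for a b c
    using yp[OF xp[OF ym[OF xm[OF that]]]] by (simp add: algebra_simps)
  have 0: "?W (0, 0, 0)"
    by (intro exI[of _ "[]"]) (simp add: heisenberg_def)
  have y: "?W (0, b, 0)" for b
  proof (induction b rule: int_induct[where k = 0])
    case base show ?case by (fact 0)
  next
    case (step1 i) then show ?case using yp[of 0 i 0] by simp
  next
    case (step2 i) then show ?case using ym[of 0 i 0] by simp
  qed
  have xy: "?W (a, b, a * b)" for a b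
  proof (induction a rule: int_induct[where k = 0])
    case base show ?case using y[of b] by simp
  next
    case (step1 i) then show ?case using xp[of i b "i * b"] by (simp add: algebra_simps)
  next
    case (step2 i) then show ?case using xm[of i b "i * b"] by (simp add: algebra_simps)
  qed
  have xyz: "?W (a, b, a * b + 2 * k)" for a b k
  proof (induction k rule: int_induct[where k = 0])
    case base show ?case using xy[of a b] by simp
  next
    case (step1 i) then show ?case
      using zp[of a b "a * b + 2 * i"] by (simp add: algebra_simps)
  next
    case (step2 i) then show ?case
      using zm[of a b "a * b + 2 * i"] by (simp add: algebra_simps)
  qed
  obtain a b c where g: "g = (a, b, c)" by (cases g)
  with assms have "even (c - a * b)" by (auto simp: heisenberg_def)
  then obtain k where "c - a * b = 2 * k" by (rule evenE)
  then have "c = a * b + 2 * k" by simp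
  with xyz[of a b k] g show ?thesis by simp
qed

end

theory Submission imports Defs begin

text \<open>
  A group element is the endpoint of a lattice path in the plane together with the signed area swept
  by the path, so balls are described exactly by an isoperimetric inequality: an element has length
  at most \<open>r\<close> iff its area fits into a box whose half perimeter is bounded in terms of \<open>r\<close> and the
  endpoint. From this description the word metric is seen to be almost convex: two neighbours in a
  ball of a vertex outside the ball are joined inside the ball by a path of bounded length,
  independently of the radius. The same then holds for any two points of a ball at bounded distance.
  Since the bound does not depend on the ball, only finitely many group elements matter for a given
  pair of points, and the connecting path survives in a limit of balls.
\<close>

section \<open>Bounded paths\<close>

text \<open>The obstacle is that unit squares do not close up in this Cayley graph. The area
  coordinate changes only along vertical edges, by the current abscissa, so two neighbours of an
  outer vertex cannot be joined simply through the opposite corner of a square: that shortcut misses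
  the required area by exactly one. Every detour below therefore goes round a second unit square
  that makes up for the missing unit. The long case distinctions only decide where this second
  square fits inside the ball. They depend on how tight the box of the vertex is, and on whether the
  square crosses the horizontal axis, where the absolute values in the length formula
  change.\<close>

inductive reach :: "('a \<Rightarrow> 'a \<Rightarrow> bool) \<Rightarrow> 'a set \<Rightarrow> nat \<Rightarrow> 'a \<Rightarrow> 'a \<Rightarrow> bool"
  for R A where
  refl: "u \<in> A \<Longrightarrow> reach R A n u u"
| step: "u \<in> A \<Longrightarrow> R u z \<Longrightarrow> reach R A n z w \<Longrightarrow> reach R A (Suc n) u w"

lemma reach_ends:
  assumes "reach R A n u w"
  shows "u \<in> A" "w \<in> A"
  using assms by (induction rule: reach.induct) auto

text \<open>The rule \<open>refl\<close> carries an arbitrary index, so the index bounds the length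
  of a path instead of counting it.\<close>

lemma reach_mono:
  assumes "reach R A n u w" "n \<le> m"
  shows "reach R A m u w"
  using assms
proof (induction arbitrary: m rule: reach.induct)
  case (step u z n w)
  then show ?case by (cases m) (auto intro: reach.step)
qed (auto intro: reach.refl)

lemma reach_trans:
  assumes "reach R A n u z" "reach R A m z w"
  shows "reach R A (n + m) u w"
  using assms
  by (induction rule: reach.induct) (auto intro: reach.step reach_mono)

lemma reach_sym:
  assumes "reach R A n u w" "\<And>x y. R x y \<Longrightarrow> R y x"
  shows "reach R A n w u"
  using assms(1)
proof (induction rule: reach.induct)
  case (step u z n w)
  have "reach R A 1 z u"
    using step assms(2) reach_ends(1)[OF step.hyps(3)] by (auto intro!: reach.intros)
  then show ?case using reach_trans[OF step.IH, of 1 u] by simp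
qed (auto intro: reach.refl)

lemma reach_map:
  assumes "reach R A n u w"
    and "\<And>x. x \<in> A \<Longrightarrow> f x \<in> A'" "\<And>x y. R x y \<Longrightarrow> R' (f x) (f y)"
  shows "reach R' A' n (f u) (f w)"
  using assms by (induction rule: reach.induct) (auto intro: reach.intros)

lemma reach_chain:
  assumes "xs \<noteq> []" "successively R xs" "set xs \<subseteq> A" "length xs \<le> Suc n"
  shows "reach R A n (hd xs) (last xs)"
proof -
  have "reach R A (length xs) (hd xs) (last xs) \<and> reach R A (length xs - 1) (hd xs) (last xs)"
    using assms(1-3)
  proof (induction xs rule: induct_list012)
    case (3 x y zs)
    then show ?case by (auto intro!: reach.step[of x _ _ y])
  qed (auto intro: reach.refl)
  then show ?thesis using assms(4) by (auto elim: reach_mono)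
qed

text \<open>A path of at most \<open>n\<close> steps only visits points within \<open>n\<close>
  steps of its start, so membership matters only there. This is how a path in one ball becomes a
  path in the limit set.\<close>

lemma reach_transfer:
  assumes "reach R A n u w" "\<And>x. reach R UNIV n u x \<Longrightarrow> x \<in> A \<Longrightarrow> x \<in> B"
  shows "reach R B n u w"
  using assms
proof (induction rule: reach.induct)
  case (refl u n)
  then show ?case by (auto intro: reach.refl)
next
  case (step u z n w)
  have "reach R UNIV (Suc n) u u" by (auto intro: reach.refl)
  then have "u \<in> B" using step by blast
  moreover have "reach R B n z w"
    using step by (auto intro: reach.step)
  ultimately show ?case using step by (auto intro: reach.step)
qed

lemma finite_reach:
  assumes "\<And>x. finite {y. R x y}"
  shows "finite {x. reach R UNIV n u x}"
proof (induction n arbitrary: u)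
  case 0
  have "{x. reach R UNIV 0 u x} \<subseteq> {u}" by (auto elim: reach.cases)
  then show ?case using finite_subset by blast
next
  case (Suc n)
  have "{x. reach R UNIV (Suc n) u x} \<subseteq> insert u (\<Union>z\<in>{z. R u z}. {x. reach R UNIV n z x})"
    by (auto elim: reach.cases)
  then show ?case using finite_subset Suc assms by (metis (no_types, lifting) finite_UN_I finite_insert)
qed

text \<open>
  This is Cannon's argument that almost convexity for points at distance 2 gives almost convexity
  for points at any distance: a path is pushed down one layer at a time, each of its excursions into
  the outermost layer consisting of a single vertex.
\<close>

locale almost_convex =
  fixes R :: "'a \<Rightarrow> 'a \<Rightarrow> bool" and A :: "nat \<Rightarrow> 'a set" and N :: nat
  assumes R_sym: "R x y \<Longrightarrow> R y x"
    and N_pos: "N \<ge> 1"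
    and A_Suc: "A r \<subseteq> A (Suc r)"
    and A_step: "x \<in> A r \<Longrightarrow> R x y \<Longrightarrow> y \<in> A (Suc r)"
    and bipartite: "v \<in> A (Suc r) \<Longrightarrow> v \<notin> A r \<Longrightarrow> R v w \<Longrightarrow> w \<in> A (Suc r) \<Longrightarrow> w \<in> A r"
    and convex2: "v \<notin> A r \<Longrightarrow> R v u \<Longrightarrow> R v w \<Longrightarrow> u \<in> A r \<Longrightarrow> w \<in> A r \<Longrightarrow> reach R (A r) N u w"
begin

lemma reach_push:
  assumes "reach R (A (Suc r)) n u w" "u \<in> A r" "w \<in> A r"
  shows "reach R (A r) (N * n) u w"
  using assms
proof (induction n arbitrary: u rule: less_induct)
  case (less n)
  from less.prems(1) show ?case
  proof cases
    case refl
    then show ?thesis using less.prems by (auto intro: reach.refl)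
  next
    case (step z m)
    show ?thesis
    proof (cases "z \<in> A r")
      case True
      have "reach R (A r) (Suc (N * m)) u w"
        using less.IH[of m z] step True less.prems by (auto intro: reach.step)
      moreover have "Suc (N * m) \<le> N * n" using step N_pos by simp
      ultimately show ?thesis by (rule reach_mono)
    next
      case False
      from step(4) show ?thesis
      proof cases
        case refl
        then show ?thesis using False less.prems by simp
      next
        case (step z' l)
        have z': "z' \<in> A r"
          using bipartite[OF _ False] step reach_ends by metis
        have "reach R (A r) N u z'"
          using convex2[OF False] R_sym \<open>R u z\<close> step z' less.prems by blast
        moreover have "reach R (A r) (N * l) z' w"
          using less.IH[of l z'] step z' less.prems \<open>n = Suc m\<close> by auto
        ultimately have "reach R (A r) (N + N * l) u w" by (rule reach_trans)
        moreover have "N + N * l \<le> N * n" using step \<open>n = Suc m\<close> by simp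
        ultimately show ?thesis by (rule reach_mono)
      qed
    qed
  qed
qed

lemma A_mono: "r \<le> s \<Longrightarrow> A r \<subseteq> A s"
  by (rule lift_Suc_mono_le[of A]) (auto simp: A_Suc)

lemma A_reach:
  assumes "reach R UNIV n u w" "u \<in> A r"
  shows "reach R (A (r + n)) n u w"
  using assms
proof (induction arbitrary: r rule: reach.induct)
  case (refl u n)
  then show ?case using A_mono[of r "r + n"] by (auto intro: reach.refl)
next
  case (step u z n w)
  have "reach R (A (Suc r + n)) n z w" using step A_step by blast
  moreover have "u \<in> A (Suc r + n)" using A_mono[of r "Suc r + n"] step by auto
  ultimately show ?case using step by (auto intro: reach.step)
qed

lemma reach_push_many:
  assumes "reach R (A (r + j)) n u w" "u \<in> A r" "w \<in> A r"
  shows "reach R (A r) (N ^ j * n) u w"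
  using assms
proof (induction j arbitrary: n)
  case (Suc j)
  have "reach R (A (r + j)) (N * n) u w"
    using Suc.prems A_mono[of r "r + j"] by (intro reach_push) auto
  then show ?case using Suc.IH[of "N * n"] Suc.prems by (simp add: mult_ac)
qed simp

text \<open>A path of length \<open>n\<close> starting in \<open>A r\<close> stays in
  \<open>A (r + n)\<close>. It is pushed down \<open>n\<close> layers, each of which multiplies its
  length by at most \<open>N\<close>.\<close>

theorem uniformly_connected:
  assumes "reach R UNIV n u w" "u \<in> A r" "w \<in> A r"
  shows "reach R (A r) (N ^ n * n) u w"
  using reach_push_many[OF A_reach] assms by blast

end

section \<open>Balls in the Heisenberg group\<close>

text \<open>
  The triple \<open>(a, b, M)\<close> stands for the group element \<open>(a, b, 2 * M - a * b)\<close>; in these coordinates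
  the parity condition on the carrier disappears.
\<close>

fun adj :: "int \<times> int \<times> int \<Rightarrow> int \<times> int \<times> int \<Rightarrow> bool" where
  "adj (a, b, M) w \<longleftrightarrow>
     w = (a + 1, b, M) \<or> w = (a - 1, b, M) \<or> w = (a, b + 1, M + a) \<or> w = (a, b - 1, M - a)"

text \<open>
  A path of area \<open>c\<close> from the origin to \<open>(a, b)\<close> of minimal length runs along the boundary of a box with
  side lengths \<open>x\<close> and \<open>y\<close>. Its length is \<open>2 * (x + y) - \<bar>a\<bar> - \<bar>b\<bar>\<close>, and the largest value of \<open>\<bar>c\<bar>\<close>
  is \<open>2 * x * y - \<bar>a * b\<bar>\<close>; for \<open>c = 2 * M - a * b\<close> this is the pair of bounds on \<open>M\<close> below.
\<close>

definition hball :: "int \<Rightarrow> (int \<times> int \<times> int) set" where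
  "hball r = {(a, b, M). \<exists>x y. \<bar>a\<bar> \<le> x \<and> \<bar>b\<bar> \<le> y \<and> 2 * (x + y) \<le> r + \<bar>a\<bar> + \<bar>b\<bar> \<and>
     \<bar>M\<bar> \<le> x * y \<and> \<bar>M - a * b\<bar> \<le> x * y}"

lemma hballI:
  assumes "\<bar>a\<bar> \<le> x" "\<bar>b\<bar> \<le> y" "2 * (x + y) \<le> r + \<bar>a\<bar> + \<bar>b\<bar>"
    and "\<bar>M\<bar> \<le> x * y" "\<bar>M - a * b\<bar> \<le> x * y"
  shows "(a, b, M) \<in> hball r"
  using assms unfolding hball_def by blast

lemma hball_posI:
  assumes "0 \<le> a" "0 \<le> b" "0 \<le> M" "a \<le> x" "b \<le> y" "2 * (x + y) \<le> r + a + b" "M \<le> x * y"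
  shows "(a, b, M) \<in> hball r"
proof (rule hballI)
  have "a * b \<le> x * y" "0 \<le> a * b" using assms by (auto intro: mult_mono)
  then show "\<bar>M - a * b\<bar> \<le> x * y" using assms by linarith
qed (use assms in auto)

lemma hballE:
  assumes "(a, b, M) \<in> hball r"
  obtains x y where "\<bar>a\<bar> \<le> x" "\<bar>b\<bar> \<le> y" "2 * (x + y) \<le> r + \<bar>a\<bar> + \<bar>b\<bar>"
    "\<bar>M\<bar> \<le> x * y" "\<bar>M - a * b\<bar> \<le> x * y"
  using assms unfolding hball_def by blast

section \<open>Symmetries of the graph and of the balls\<close>

fun refl_x refl_y swap :: "int \<times> int \<times> int \<Rightarrow> int \<times> int \<times> int" where
  "refl_x (a, b, M) = (a, - b, - M)"
| "refl_y (a, b, M) = (- a, b, - M)"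
| "swap (a, b, M) = (b, a, a * b - M)"

lemma refl_refl [simp]: "refl_x (refl_x v) = v" "refl_y (refl_y v) = v" "swap (swap v) = v"
  by (cases v; simp)+

lemma adj_sym: "adj u v \<Longrightarrow> adj v u"
  by (cases u; cases v) auto

lemma adj_refl: "adj u v \<Longrightarrow> adj (refl_x u) (refl_x v)" "adj u v \<Longrightarrow> adj (refl_y u) (refl_y v)"
  "adj u v \<Longrightarrow> adj (swap u) (swap v)"
  by (cases u; cases v; auto simp: algebra_simps)+

lemma hball_refl_x: "v \<in> hball r \<Longrightarrow> refl_x v \<in> hball r"
  unfolding hball_def by (cases v) (auto simp: abs_minus_commute)

lemma hball_refl_y: "v \<in> hball r \<Longrightarrow> refl_y v \<in> hball r"
  unfolding hball_def by (cases v) (auto simp: abs_minus_commute)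

lemma hball_swap:
  assumes "v \<in> hball r"
  shows "swap v \<in> hball r"
proof -
  obtain a b M where v: "v = (a, b, M)" by (cases v)
  from assms[unfolded v] show ?thesis
  proof (cases rule: hballE)
    case (1 x y)
    then show ?thesis unfolding v swap.simps by (intro hballI[of _ y _ x]) (auto simp: algebra_simps)
  qed
qed

lemmas hball_refl = hball_refl_x hball_refl_y hball_swap

lemma hball_refl_iff [simp]: "refl_x v \<in> hball r \<longleftrightarrow> v \<in> hball r"
  "refl_y v \<in> hball r \<longleftrightarrow> v \<in> hball r" "swap v \<in> hball r \<longleftrightarrow> v \<in> hball r"
  using hball_refl refl_refl by metis+

text \<open>
  A fundamental domain for the symmetries. The boundary ray \<open>a = 0 < b\<close> is left out because there the
  western neighbour of an outer vertex can lie in the ball without the southern one; for \<open>a \<ge> 1\<close> this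
  is impossible, so that only three pairs of neighbours have to be joined.
\<close>

fun octant :: "int \<times> int \<times> int \<Rightarrow> bool" where
  "octant (a, b, M) \<longleftrightarrow> (a \<ge> 1 \<and> b \<ge> 0 \<or> a = 0 \<and> b = 0) \<and> 2 * M \<ge> a * b"

text \<open>Reflections make both plane coordinates nonnegative. After that \<open>swap\<close>
  stays in the quadrant and negates \<open>2 * M - a * b\<close>.\<close>

lemma octant_cases:
  assumes "\<And>v. Q (refl_x v) \<Longrightarrow> Q v" "\<And>v. Q (refl_y v) \<Longrightarrow> Q v" "\<And>v. Q (swap v) \<Longrightarrow> Q v"
    and oct: "\<And>v. octant v \<Longrightarrow> Q v"
  shows "Q v"
proof -
  have 1: "Q (a, b, M)" if "a \<ge> 1 \<and> b \<ge> 0 \<or> a = 0 \<and> b = 0" for a b M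
  proof (cases "2 * M \<ge> a * b")
    case True
    then show ?thesis using that oct by simp
  next
    case False
    \<comment> \<open>For \<open>b = 0\<close> the map \<open>swap\<close> would land on the
      excluded ray, so there \<open>refl_x\<close> changes the sign of \<open>M\<close>
      instead.\<close>
    show ?thesis
    proof (cases "b = 0")
      case True
      then show ?thesis using False that oct[of "refl_x (a, b, M)"] assms(1) by simp
    next
      case nz: False
      then have "octant (swap (a, b, M))" using that False by (auto simp: algebra_simps)
      then show ?thesis using oct assms(3) by blast
    qed
  qed
  have 2: "Q (a, b, M)" if "a \<ge> 0" "b \<ge> 0" for a b M
  proof (cases "a \<ge> 1 \<or> b = 0")
    case True
    then show ?thesis using that by (intro 1) arith
  next
    case False
    then show ?thesis using 1[of b a "a * b - M"] assms(3)[of "(a, b, M)"] that by simp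
  qed
  have 3: "Q (a, b, M)" if "b \<ge> 0" for a b M
    using 2[of a b M] 2[of "- a" b "- M"] assms(2)[of "(a, b, M)"] that by fastforce
  obtain a b M where "v = (a, b, M)" by (cases v)
  then show ?thesis
    using 3[of b a M] 3[of "- b" a "- M"] assms(1)[of "(a, b, M)"] by fastforce
qed

section \<open>Parity and one-step growth of the balls\<close>

lemma hball_mono: "r \<le> s \<Longrightarrow> hball r \<subseteq> hball s"
  unfolding hball_def by (fastforce)

lemma hball_parity:
  assumes "(a, b, M) \<in> hball (r + 1)" "even (r + a + b)"
  shows "(a, b, M) \<in> hball r"
  using assms(1)
proof (cases rule: hballE)
  case (1 x y)
  have "even (r + \<bar>a\<bar> + \<bar>b\<bar>)" using assms(2) by (simp add: abs_if)
  then have "2 * (x + y) \<noteq> r + 1 + \<bar>a\<bar> + \<bar>b\<bar>"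
    by (metis add.assoc add.commute dvd_triv_left even_plus_one_iff)
  then show ?thesis using 1 by (intro hballI[of _ x _ y]) auto
qed

text \<open>Every edge changes the parity of \<open>a + b\<close>, so no edge joins two vertices of
  the same sphere.\<close>

lemma hball_bipartite:
  assumes "v \<in> hball (r + 1)" "v \<notin> hball r" "adj v w" "w \<in> hball (r + 1)"
  shows "w \<in> hball r"
proof -
  obtain a b M where v: "v = (a, b, M)" by (cases v)
  have "odd (r + a + b)" using hball_parity assms v by blast
  moreover obtain a' b' M' where w: "w = (a', b', M')" by (cases w)
  ultimately have "even (r + a' + b')" using assms(3) v by auto
  then show ?thesis using assms(4) hball_parity w by blast
qed

text \<open>Moving away from the vertical axis, the box is widened by one column. Moving towards it,
  the same box serves: \<open>\<bar>a\<bar>\<close> drops by the unit that the radius gains, and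
  \<open>M - (a + 1) * b\<close> lies between \<open>M - a * b\<close> and \<open>M\<close>.\<close>

lemma hball_east:
  assumes "(a, b, M) \<in> hball r"
  shows "(a + 1, b, M) \<in> hball (r + 1)"
  using assms
proof (cases rule: hballE)
  case (1 x y)
  show ?thesis
  proof (cases "a \<ge> 0")
    case True
    then show ?thesis using 1 by (intro hballI[of _ "x + 1" _ y]) (auto simp: algebra_simps)
  next
    case False
    have "\<bar>M - (a + 1) * b\<bar> \<le> x * y"
    proof (cases "b \<ge> 0")
      case True
      then have "a * b \<le> (a + 1) * b" "(a + 1) * b \<le> 0"
        using False by (auto simp: mult_right_mono intro: mult_nonpos_nonneg)
      then show ?thesis using 1 by linarith
    next
      case nb: False
      then have "(a + 1) * b \<le> a * b" "(a + 1) * b \<ge> 0"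
        using False by (auto simp: mult_right_mono_neg intro: mult_nonpos_nonpos)
      then show ?thesis using 1 by linarith
    qed
    then show ?thesis using 1 False by (intro hballI[of _ x _ y]) auto
  qed
qed

lemma hball_adj:
  assumes "v \<in> hball r" "adj v w"
  shows "w \<in> hball (r + 1)"
proof -
  have east: "(a + 1, b, M) \<in> hball (r + 1)" if "(a, b, M) \<in> hball r" for a b M
    using that by (rule hball_east)
  have west: "(a - 1, b, M) \<in> hball (r + 1)" if "(a, b, M) \<in> hball r" for a b M
    using east[of "- a" b "- M"] hball_refl_iff(2)[of "(a, b, M)"] that
      hball_refl_iff(2)[of "(a - 1, b, M)" "r + 1"] by simp
  have north: "(a, b + 1, M + a) \<in> hball (r + 1)" if "(a, b, M) \<in> hball r" for a b M
    using east[of b a "a * b - M"] hball_refl_iff(3)[of "(a, b, M)"] that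
      hball_refl_iff(3)[of "(a, b + 1, M + a)" "r + 1"] by (simp add: algebra_simps)
  have south: "(a, b - 1, M - a) \<in> hball (r + 1)" if "(a, b, M) \<in> hball r" for a b M
    using west[of b a "a * b - M"] hball_refl_iff(3)[of "(a, b, M)"] that
      hball_refl_iff(3)[of "(a, b - 1, M - a)" "r + 1"] by (simp add: algebra_simps)
  show ?thesis using assms east west north south by (cases v) auto
qed

section \<open>Almost convexity\<close>

text \<open>Detours that start near the horizontal axis dip into the fourth quadrant. There
  \<open>a * d \<ge> 0\<close> turns two of the four one-sided bounds into consequences of the other
  two.\<close>

lemma hball_negI:
  assumes "0 \<le> a" "0 \<le> d" "a \<le> x" "d \<le> y" "2 * (x + y) \<le> r + a + d"
    and "M + a * d \<le> x * y" "- M \<le> x * y"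
  shows "(a, - d, M) \<in> hball r"
proof (rule hballI)
  have "0 \<le> a * d" using assms by simp
  then show "\<bar>M\<bar> \<le> x * y" "\<bar>M - a * - d\<bar> \<le> x * y"
    using assms unfolding mult_minus_right by linarith+
qed (use assms in auto)

text \<open>As \<open>r + a + b = 2 * k - 1\<close>, boxes certifying \<open>(a, b, M)\<close> in
  \<open>hball r\<close> have half perimeter at most \<open>k - 1\<close>, and at most
  \<open>k\<close> in the next ball. The budget is also \<open>k\<close> for the eastern and
  northern neighbours, and \<open>k - 1\<close> for the western and southern ones when these stay in
  the quadrant.\<close>

locale outer_vertex =
  fixes a b M r k :: int
  assumes octant: "octant (a, b, M)"
    and outside: "(a, b, M) \<notin> hball r"
    and r: "r = 2 * k - 1 - a - b"
begin

lemma nonneg: "0 \<le> a" "0 \<le> b" "0 \<le> M"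
proof -
  show "0 \<le> a" "0 \<le> b" using octant by auto
  then have "0 \<le> a * b" by simp
  then show "0 \<le> M" using octant by auto
qed

lemma minimal:
  assumes "a \<le> x" "b \<le> y" "M \<le> x * y"
  shows "k \<le> x + y"
proof (rule ccontr)
  assume "\<not> k \<le> x + y"
  then have "(a, b, M) \<in> hball r" using assms nonneg r by (intro hball_posI[of a b M x y]) auto
  then show False using outside by simp
qed

lemma eastE:
  assumes "(a + 1, b, M) \<in> hball r"
  obtains x y where "a + 1 \<le> x" "b \<le> y" "x + y = k" "M \<le> x * y"
  using assms
proof (cases rule: hballE)
  case (1 x y)
  then have "x + y \<le> k" using nonneg r by auto
  moreover have "k \<le> x + y" using 1 nonneg by (intro minimal) auto
  ultimately show ?thesis using that[of x y] 1 nonneg by auto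
qed

text \<open>A box of width exactly \<open>a\<close> is impossible: removing its top row costs area
  \<open>a\<close>, and what remains would be too small a box for the outer vertex.\<close>

lemma northE:
  assumes "(a, b + 1, M + a) \<in> hball r"
  obtains x y where "a + 1 \<le> x" "b + 1 \<le> y" "x + y = k" "M + a \<le> x * y"
  using assms
proof (cases rule: hballE)
  case (1 x y)
  then have le: "x + y \<le> k" using nonneg r by auto
  moreover have ge: "k \<le> x + y" using 1 nonneg by (intro minimal) auto
  moreover have "x \<noteq> a"
  proof
    assume "x = a"
    then have "k \<le> a + (y - 1)" using 1 nonneg by (intro minimal) (auto simp: algebra_simps)
    then show False using le ge \<open>x = a\<close> by simp
  qed
  ultimately show ?thesis using that[of x y] 1 nonneg by auto
qed

text \<open>A box of width at least \<open>a\<close> would already contain the outer vertex within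
  budget \<open>k - 1\<close>. Hence the width is \<open>a - 1\<close>, and minimality after adding
  one column fixes the height.\<close>

lemma westE:
  assumes "(a - 1, b, M) \<in> hball r" "a \<ge> 1"
  obtains y where "b \<le> y" "a + y = k" "M \<le> (a - 1) * y"
  using assms(1)
proof (cases rule: hballE)
  case (1 x y)
  then have le: "x + y \<le> k - 1" using nonneg r assms(2) by auto
  have "\<not> a \<le> x" using minimal[of x y] 1 nonneg le by auto
  then have x: "x = a - 1" using 1 nonneg by auto
  have "M \<le> a * y" using 1 nonneg x by (auto simp: algebra_simps)
  then have "k \<le> a + y" using 1 nonneg by (intro minimal) auto
  then show ?thesis using that[of y] x 1 le nonneg by auto
qed

text \<open>The box found is widened until its half perimeter is exactly \<open>k - 1\<close>, which
  only weakens the area bounds.\<close>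

lemma southE:
  assumes "(a, b - 1, M - a) \<in> hball r" "b \<ge> 1"
  obtains p q where "a \<le> p" "b - 1 \<le> q" "p + q = k - 1" "M - a \<le> p * q" "a * b - M \<le> p * q"
  using assms(1)
proof (cases rule: hballE)
  case (1 x y)
  then have le: "x \<le> k - 1 - y" using nonneg r assms(2) by auto
  have "x * y \<le> (k - 1 - y) * y" using le 1 by (intro mult_right_mono) auto
  then show ?thesis using that[of "k - 1 - y" y] 1 le nonneg assms(2) by (auto simp: algebra_simps)
qed

subsection \<open>Monotone geodesics\<close>

text \<open>The smallest conceivable box, \<open>a\<close> by \<open>b\<close>, is already large
  enough.\<close>

lemma inner_k:
  assumes "M \<le> a * b" "(a, b, M) \<in> hball (r + 1)"
  shows "k = a + b"
proof (rule antisym)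
  show "k \<le> a + b" using assms by (intro minimal) auto
  show "a + b \<le> k" using assms(2) by (cases rule: hballE) (use nonneg r in auto)
qed

text \<open>Going round the corner \<open>(a - 1, b - 1)\<close> gives one unit of area too much.
  The unit square diagonally below that corner, traversed on the way, removes it.\<close>

lemma inner_west_south:
  assumes k: "k = a + b" and "a \<ge> 1" "b \<ge> 1"
    and west: "(a - 1, b, M) \<in> hball r" and south: "(a, b - 1, M - a) \<in> hball r"
  shows "reach adj (hball r) 6 (a - 1, b, M) (a, b - 1, M - a)"
proof -
  obtain y where "b \<le> y" "a + y = k" "M \<le> (a - 1) * y" using westE assms by metis
  then have M1: "M \<le> (a - 1) * b" using k by simp
  obtain p q where pq: "a \<le> p" "b - 1 \<le> q" "p + q = k - 1" "a * b - M \<le> p * q"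
    using southE assms by metis
  then have "p = a" "q = b - 1" using k by auto
  then have M2: "a \<le> M" using pq(4) unfolding \<open>p = a\<close> \<open>q = b - 1\<close> by (simp add: algebra_simps)
  \<comment> \<open>\<open>(A, B)\<close> is the corner opposite the outer vertex, and
    \<open>m\<close> is the area on arriving there from the west neighbour.\<close>
  define A B m where "A = a - 1" "B = b - 1" "m = M - a + 1"
  have m: "1 \<le> m" "m \<le> A * B" using M1 M2 by (auto simp: A_B_m_def algebra_simps)
  have "A \<ge> 0" "B \<ge> 0" using assms by (auto simp: A_B_m_def)
  moreover have "A \<noteq> 0" "B \<noteq> 0" using m by auto
  ultimately have AB: "A \<ge> 1" "B \<ge> 1" by auto
  then have prods: "A \<le> A * B" "B \<le> A * B" "A + B \<le> A * B + 1"
    using mult_nonneg_nonneg[of "A - 1" "B - 1"] by (auto simp: algebra_simps)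
  have r': "r = A + B + 1" using r k by (simp add: A_B_m_def)
  have v1: "(A, B, m) \<in> hball r" "(A - 1, B, m - 1) \<in> hball r" "(A, B, m - 1) \<in> hball r"
    using m AB by (auto simp: r' intro!: hball_posI[of _ _ _ A B])
  have v2: "(A, B - 1, m - A) \<in> hball r"
    using m AB prods by (intro hballI[of _ A _ B]) (auto simp: r' algebra_simps)
  have v3: "(A - 1, B - 1, m - A) \<in> hball r"
  proof (cases "m \<ge> A")
    case True
    then show ?thesis
      using m AB by (intro hball_posI[of _ _ _ A "B - 1"]) (auto simp: r' algebra_simps)
  next
    case False
    then show ?thesis
      using m AB prods by (intro hballI[of _ "A - 1" _ B]) (auto simp: r' algebra_simps)
  qed
  have "reach adj (hball r) 6 (A, B + 1, M) (A + 1, B, M - a)"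
    using reach_chain[of "[(A, B + 1, M), (A, B, m), (A, B - 1, m - A), (A - 1, B - 1, m - A),
      (A - 1, B, m - 1), (A, B, m - 1), (A + 1, B, M - a)]" adj "hball r" 6] v1 v2 v3 west south
    by (auto simp: A_B_m_def)
  then show ?thesis by (simp add: A_B_m_def)
qed

end

subsection \<open>Geodesics along three sides of a rectangle\<close>

locale outer_vertex_big = outer_vertex +
  assumes big: "M > a * b" and a1: "a \<ge> 1"
begin

lemma M1: "M \<ge> 1"
proof -
  have "a * b \<ge> 0" using nonneg by simp
  then show ?thesis using big by linarith
qed

text \<open>Through the corner \<open>(a + 1, b + 1)\<close> the area comes out one too large, so a
  clockwise unit square south-east of the start is inserted first. Only the northern neighbour is
  assumed to lie in the ball.\<close>

lemma north_east:
  assumes north: "(a, b + 1, M + a) \<in> hball r"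
  shows "reach adj (hball r) 8 (a + 1, b, M) (a, b + 1, M + a)"
proof -
  obtain x y where xy: "a + 1 \<le> x" "b + 1 \<le> y" "x + y = k" "M + a \<le> x * y"
    using northE[OF north] by blast
  have n: "(a + 1, b + 1, M + a) \<in> hball r"
    using xy nonneg by (intro hball_posI[of _ _ _ x y]) (auto simp: r)
  have e: "(a + 1, b, M) \<in> hball r"
    using xy nonneg by (intro hball_posI[of _ _ _ x y]) (auto simp: r)
  show ?thesis
  proof (cases "x = a + 1")
    case True
    \<comment> \<open>In the narrow box, minimality leaves a single possible value of
      \<open>M\<close>.\<close>
    have "\<not> M \<le> (a + 1) * (y - 1)" using minimal[of "a + 1" "y - 1"] xy True by auto
    then have M: "M = (a + 1) * y - a" using xy True by (auto simp: algebra_simps)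
    have "\<not> M \<le> a * y" using minimal[of a y] xy True by auto
    then have y: "y > a" using M by (auto simp: algebra_simps)
    have v1: "(a + 2, b, M) \<in> hball r"
      using xy nonneg y a1 True M
      by (intro hball_posI[of _ _ _ "a + 2" "y - 1"]) (auto simp: r algebra_simps)
    have v2: "(a + 1, b, M - 1) \<in> hball r"
      using xy nonneg y a1 True M M1
      by (intro hball_posI[of _ _ _ "a + 1" "y - 1"]) (auto simp: r algebra_simps)
    have v3: "(a + 2, b - 1, M - a - 2) \<in> hball r \<and> (a + 1, b - 1, M - a - 2) \<in> hball r"
    proof (cases "b = 0")
      case True
      have "(a + 2, - 1, M - a - 2) \<in> hball r"
        using xy nonneg y a1 \<open>x = a + 1\<close> M True M1
        by (intro hball_negI[of _ _ "a + 2" y]) (auto simp: r algebra_simps)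
      moreover have "(a + 1, - 1, M - a - 2) \<in> hball r"
        using xy nonneg y a1 \<open>x = a + 1\<close> M True M1
        by (intro hball_negI[of _ _ "a + 1" y]) (auto simp: r algebra_simps)
      ultimately show ?thesis using True by simp
    next
      case False
      then have "(a + 1) * 2 \<le> (a + 1) * y" using xy nonneg by (intro mult_left_mono) auto
      then have "M - a - 2 \<ge> 0" using M by simp
      have "(a + 2, b - 1, M - a - 2) \<in> hball r"
        using xy nonneg y a1 \<open>x = a + 1\<close> M False \<open>M - a - 2 \<ge> 0\<close>
        by (intro hball_posI[of _ _ _ "a + 2" "y - 1"]) (auto simp: r algebra_simps)
      moreover have "(a + 1, b - 1, M - a - 2) \<in> hball r"
        using xy nonneg y a1 \<open>x = a + 1\<close> M False \<open>M - a - 2 \<ge> 0\<close>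
        by (intro hball_posI[of _ _ _ "a + 1" "y - 1"]) (auto simp: r algebra_simps)
      ultimately show ?thesis by simp
    qed
    show ?thesis
      using reach_chain[of "[(a + 1, b, M), (a + 2, b, M), (a + 2, b - 1, M - a - 2),
        (a + 1, b - 1, M - a - 2), (a + 1, b, M - 1), (a + 1, b + 1, M + a), (a, b + 1, M + a)]"
        adj "hball r" 8] v1 v2 v3 n e north by auto
  next
    case False
    \<comment> \<open>For \<open>b \<ge> 1\<close> the point below the start only has budget
      \<open>k - 1\<close>. One column further east the budget is \<open>k\<close> again, so the
      square is moved there.\<close>
    then have x: "a + 2 \<le> x" using xy by simp
    have prod: "(a + 2) * (b + 1) \<le> x * y" using x xy nonneg by (intro mult_mono) auto
    have v1: "(a + 2, b, M) \<in> hball r" "(a + 2, b, M - 1) \<in> hball r" "(a + 1, b, M - 1) \<in> hball r"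
      using xy nonneg a1 x M1 by (auto simp: r intro!: hball_posI[of _ _ _ x y])
    have v2: "(a + 3, b, M) \<in> hball r"
      using xy nonneg a1 x by (intro hball_posI[of _ _ _ "x + 1" y]) (auto simp: r algebra_simps)
    have v3: "(a + 3, b - 1, M - a - 3) \<in> hball r \<and> (a + 2, b - 1, M - a - 3) \<in> hball r"
    proof (cases "b = 0")
      case True
      have "(a + 3, - 1, M - a - 3) \<in> hball r"
        using xy nonneg a1 x prod M1 True
        by (intro hball_negI[of _ _ "x + 1" y]) (auto simp: r algebra_simps)
      moreover have "(a + 2, - 1, M - a - 3) \<in> hball r"
        using xy nonneg a1 x prod M1 True
        by (intro hball_negI[of _ _ "x" y]) (auto simp: r algebra_simps)
      ultimately show ?thesis using True by simp
    next
      case b: False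
      then have "a \<le> a * b" using nonneg a1 by simp
      then have ab: "a + 1 \<le> M" "M + a \<le> x * y + a * b" using big xy a1 by linarith+
      have "(a + 2, b - 1, M - a - 3) \<in> hball r"
        using xy nonneg a1 x prod big b ab
        by (intro hballI[of _ x _ y]) (auto simp: r algebra_simps)
      moreover have "(a + 3, b - 1, M - a - 3) \<in> hball r"
      proof (cases "x = a + 2")
        case True
        have "(a + 3) * b \<le> (a + 3) * (y - 1)" using xy nonneg by (intro mult_left_mono) auto
        then show ?thesis
          using xy nonneg a1 True big b ab
          by (intro hballI[of _ "x + 1" _ "y - 1"]) (auto simp: r algebra_simps)
      next
        case False
        then have "(a + 3) * (b + 1) \<le> x * y" using x xy nonneg by (intro mult_mono) auto
        then show ?thesis
          using xy nonneg a1 x False big b ab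
          by (intro hballI[of _ x _ y]) (auto simp: r algebra_simps)
      qed
      ultimately show ?thesis by simp
    qed
    show ?thesis
      using reach_chain[of "[(a + 1, b, M), (a + 2, b, M), (a + 3, b, M), (a + 3, b - 1, M - a - 3),
        (a + 2, b - 1, M - a - 3), (a + 2, b, M - 1), (a + 1, b, M - 1), (a + 1, b + 1, M + a),
        (a, b + 1, M + a)]" adj "hball r" 8] v1 v2 v3 n e north by auto
  qed
qed

text \<open>By \<open>westE\<close> the area fits into a box one column narrower. This slack leaves
  room for the detour of \<open>inner_west_south\<close>, and also puts the southern neighbour in
  the ball.\<close>

lemma west_south:
  assumes west: "(a - 1, b, M) \<in> hball r"
  shows "reach adj (hball r) 6 (a - 1, b, M) (a, b - 1, M - a)"
proof -
  obtain y where y: "b \<le> y" "k = a + y" "M \<le> (a - 1) * y" using westE[OF west a1] by metis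
  have "a \<noteq> 1" using y M1 by auto
  then have a2: "a \<ge> 2" using a1 by simp
  have "y \<noteq> b" using y big nonneg by (auto simp: algebra_simps)
  then have yb: "y \<ge> b + 1" using y by simp
  have ay: "a - 1 \<le> (a - 1) * y" using a2 yb nonneg by simp
  \<comment> \<open>The square reaches down to row \<open>b - 2\<close>, so the sign of that row
    decides the criterion.\<close>
  consider (b0) "b = 0" | (b1) "b = 1" | (b2) "b \<ge> 2" using nonneg by linarith
  then show ?thesis
  proof cases
    case b2
    have "a * 2 \<le> a * b" using b2 nonneg by (intro mult_left_mono) auto
    then have Ma: "M \<ge> 2 * a + 1" using big by simp
    have v: "(a - 1, b - 1, M - a + 1) \<in> hball r" "(a - 2, b - 1, M - a) \<in> hball r"
      "(a - 1, b - 1, M - a) \<in> hball r"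
      using y yb a2 b2 Ma
      by (auto simp: r algebra_simps intro!: hball_posI[of _ _ _ "a - 1" "y - 1"])
    have v': "(a - 1, b - 2, M - 2 * a + 2) \<in> hball r" "(a - 2, b - 2, M - 2 * a + 2) \<in> hball r"
      using y yb a2 b2 Ma
      by (auto simp: r algebra_simps intro!: hball_posI[of _ _ _ "a - 1" "y - 2"])
    have "(a, b - 1, M - a) \<in> hball r"
      using y yb a2 b2 Ma by (intro hball_posI[of _ _ _ a "y - 1"]) (auto simp: r algebra_simps)
    then show ?thesis
      using reach_chain[of "[(a - 1, b, M), (a - 1, b - 1, M - a + 1), (a - 1, b - 2, M - 2 * a + 2),
        (a - 2, b - 2, M - 2 * a + 2), (a - 2, b - 1, M - a), (a - 1, b - 1, M - a), (a, b - 1, M - a)]"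
        adj "hball r" 6] v v' west by auto
  next
    case b1
    then have Ma: "M \<ge> a + 1" using big by simp
    have y2: "(a - 1) * 2 \<le> (a - 1) * y" using yb b1 a2 by (intro mult_left_mono) auto
    have v: "(a - 1, 0, M - a + 1) \<in> hball r" "(a - 2, 0, M - a) \<in> hball r"
      "(a - 1, 0, M - a) \<in> hball r"
      using y yb a2 b1 Ma
      by (auto simp: r algebra_simps intro!: hball_posI[of _ _ _ "a - 1" "y - 1"])
    have v': "(a - 1, - 1, M - 2 * a + 2) \<in> hball r" "(a - 2, - 1, M - 2 * a + 2) \<in> hball r"
      using y yb a2 b1 Ma y2
      by (auto simp: r algebra_simps intro!: hball_negI[of _ _ "a - 1" "y - 1"])
    have "(a, 0, M - a) \<in> hball r"
      using y yb a2 b1 Ma by (intro hball_posI[of _ _ _ a "y - 1"]) (auto simp: r algebra_simps)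
    then show ?thesis
      using reach_chain[of "[(a - 1, b, M), (a - 1, 0, M - a + 1), (a - 1, - 1, M - 2 * a + 2),
        (a - 2, - 1, M - 2 * a + 2), (a - 2, 0, M - a), (a - 1, 0, M - a), (a, 0, M - a)]"
        adj "hball r" 6] v v' west b1 by auto
  next
    case b0
    have s: "(a, - 1, M - a) \<in> hball r"
      using y yb a2 b0 M1 ay by (intro hball_negI[of _ _ a y]) (auto simp: r algebra_simps)
    have v: "(a - 1, - 1, M - a + 1) \<in> hball r" "(a - 1, - 1, M - a) \<in> hball r"
      using y yb a2 b0 M1 ay
      by (auto simp: r algebra_simps intro!: hball_negI[of _ _ "a - 1" y])
    show ?thesis
    \<comment> \<open>A box of height one cannot contain row \<open>-2\<close>, so here the square
      lies between rows \<open>0\<close> and \<open>-1\<close>.\<close>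
    proof (cases "y = 1")
      case True
      have v': "(a - 2, - 1, M - a + 1) \<in> hball r"
        using y yb a2 b0 M1 ay by (intro hball_negI[of _ _ "a - 1" y]) (auto simp: r algebra_simps)
      have v'': "(a - 2, 0, M - 1) \<in> hball r"
        using y True a2 b0 M1 by (intro hball_posI[of _ _ _ "a - 2" 1]) (auto simp: r)
      have "(a - 1, 0, M - 1) \<in> hball r"
        using y True a2 b0 M1 by (intro hball_posI[of _ _ _ "a - 1" 1]) (auto simp: r)
      then show ?thesis
        using reach_chain[of "[(a - 1, b, M), (a - 1, - 1, M - a + 1), (a - 2, - 1, M - a + 1),
          (a - 2, 0, M - 1), (a - 1, 0, M - 1), (a - 1, - 1, M - a), (a, - 1, M - a)]"
          adj "hball r" 6] v v' v'' west s b0 by auto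
    next
      case False
      then have y2: "(a - 1) * 2 \<le> (a - 1) * y" using yb b0 a2 by (intro mult_left_mono) auto
      have v1: "(a - 1, - 2, M - 2 * a + 2) \<in> hball r"
        using y yb a2 b0 M1 y2
        by (intro hball_negI[of _ _ "a - 1" "y + 1"]) (auto simp: r algebra_simps)
      have v2: "(a - 2, - 2, M - 2 * a + 2) \<in> hball r"
        using y yb a2 b0 M1 y2 False
        by (intro hball_negI[of _ _ "a - 1" y]) (auto simp: r algebra_simps)
      have v3: "(a - 2, - 1, M - a) \<in> hball r"
        using y yb a2 b0 M1 ay by (intro hball_negI[of _ _ "a - 1" y]) (auto simp: r algebra_simps)
      show ?thesis
        using reach_chain[of "[(a - 1, b, M), (a - 1, - 1, M - a + 1), (a - 1, - 2, M - 2 * a + 2),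
          (a - 2, - 2, M - 2 * a + 2), (a - 2, - 1, M - a), (a - 1, - 1, M - a), (a, - 1, M - a)]"
          adj "hball r" 6] v v1 v2 v3 west s b0 by auto
    qed
  qed
qed

text \<open>The hypotheses on \<open>q\<close> say that the southern neighbour fits into a box of
  width \<open>a + 1\<close>. The missing unit is then gained from the square just below, in columns
  \<open>a\<close> and \<open>a + 1\<close>.\<close>

lemma east_south_near:
  assumes b1: "b \<ge> 1"
    and east: "(a + 1, b, M) \<in> hball r" and south: "(a, b - 1, M - a) \<in> hball r"
    and q: "1 \<le> q" "b - 1 \<le> q" "a + 1 + q = k - 1" "M - a \<le> (a + 1) * q"
  shows "reach adj (hball r) 6 (a + 1, b, M) (a, b - 1, M - a)"
proof -
  have "a \<le> a * b" using a1 b1 by simp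
  then have Ma: "M \<ge> a + 1" using big by simp
  have "a * 1 \<le> a * q" using q nonneg by (intro mult_left_mono) auto
  then have aq: "2 * a + 1 \<le> M + a * q" using Ma by simp
  have v: "(a + 1, b - 1, M - a - 1) \<in> hball r" "(a, b - 1, M - a - 1) \<in> hball r"
    "(a + 1, b - 1, M - a) \<in> hball r"
    using q b1 Ma nonneg
    by (auto simp: r algebra_simps intro!: hball_posI[of _ _ _ "a + 1" q])
  have v': "(a, b - 2, M - 2 * a - 1) \<in> hball r \<and> (a + 1, b - 2, M - 2 * a - 1) \<in> hball r"
  proof (cases "b = 1")
    case True
    have "(a, - 1, M - 2 * a - 1) \<in> hball r"
      using q True Ma nonneg aq by (intro hball_negI[of _ _ "a + 1" q]) (auto simp: r algebra_simps)
    moreover have "(a + 1, - 1, M - 2 * a - 1) \<in> hball r"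
      using q True Ma nonneg aq
      by (intro hball_negI[of _ _ "a + 1" "q + 1"]) (auto simp: r algebra_simps)
    ultimately show ?thesis using True by simp
  next
    case False
    then have "a * 2 \<le> a * b" using b1 nonneg by (intro mult_left_mono) auto
    then have "M \<ge> 2 * a + 1" using big by simp
    then have "(a, b - 2, M - 2 * a - 1) \<in> hball r"
      using q b1 False nonneg
      by (intro hball_posI[of _ _ _ "a + 1" "q - 1"]) (auto simp: r algebra_simps)
    moreover have "(a + 1, b - 2, M - 2 * a - 1) \<in> hball r"
      using q b1 False nonneg \<open>M \<ge> 2 * a + 1\<close>
      by (intro hball_posI[of _ _ _ "a + 1" q]) (auto simp: r algebra_simps)
    ultimately show ?thesis by simp
  qed
  show ?thesis
    using reach_chain[of "[(a + 1, b, M), (a + 1, b - 1, M - a - 1), (a, b - 1, M - a - 1),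
      (a, b - 2, M - 2 * a - 1), (a + 1, b - 2, M - 2 * a - 1), (a + 1, b - 1, M - a),
      (a, b - 1, M - a)]" adj "hball r" 6] v v' east south by auto
qed

lemma east_south_flat:
  assumes b0: "b = 0"
    and east: "(a + 1, b, M) \<in> hball r" and south: "(a, b - 1, M - a) \<in> hball r"
  shows "reach adj (hball r) 8 (a + 1, b, M) (a, b - 1, M - a)"
proof -
  obtain x y where xy: "a + 1 \<le> x" "b \<le> y" "k = x + y" "M \<le> x * y"
    using eastE[OF east] by metis
  have "y \<noteq> 0" using xy M1 by auto
  then have y1: "y \<ge> 1" using xy b0 by simp
  have "\<not> M \<le> a" using minimal[of a 1] xy y1 b0 by auto
  then have Ma: "M \<ge> a + 1" by simp
  show ?thesis
  \<comment> \<open>The general detour needs \<open>3 * a - M \<le> 3 * (x' - 1)\<close> when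
    \<open>y' = 2\<close>. For \<open>x' = a\<close> this means \<open>M \<ge> 3\<close>, which
    \<open>M \<ge> a + 1\<close> yields except in this case.\<close>
  proof (cases "a = 1 \<and> M = 2")
    case True
    have "k = 3" using minimal[of 1 2] True xy y1 b0 by auto
    then have v: "(2, - 1, 0) \<in> hball r" "(1, - 1, 0) \<in> hball r" "(0, - 1, 0) \<in> hball r"
      "(0, - 2, 0) \<in> hball r" "(1, - 2, 0) \<in> hball r"
      using True b0
      by (auto simp: r intro: hball_negI[of _ _ 2 1] hball_negI[of _ _ 1 1]
          hball_negI[of _ _ 0 1] hball_negI[of _ _ 0 2] hball_negI[of _ _ 1 2])
    show ?thesis
      using reach_chain[of "[(2, 0, 2), (2, - 1, 0), (1, - 1, 0), (0, - 1, 0), (0, - 2, 0),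
        (1, - 2, 0), (1, - 1, 1)]" adj "hball r" 8] v east south True b0 by auto
  next
    case False
    \<comment> \<open>A box \<open>x\<close> by \<open>1\<close> is traded for \<open>x - 1\<close>
      by \<open>2\<close>, which loses no area because \<open>x \<ge> 2\<close>.\<close>
    have "\<exists>x' y'. a \<le> x' \<and> 2 \<le> y' \<and> x' + y' = k \<and> M \<le> x' * y'"
    proof (cases "y = 1")
      case True
      then show ?thesis using xy a1 by (intro exI[of _ "x - 1"] exI[of _ 2]) auto
    next
      case False
      then show ?thesis using xy y1 by (intro exI[of _ x] exI[of _ y]) auto
    qed
    then obtain x' y' where xy': "a \<le> x'" "2 \<le> y'" "x' + y' = k" "M \<le> x' * y'" by blast
    have "a * 2 \<le> x' * y'" using xy' nonneg by (intro mult_mono) auto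
    have "\<exists>x3 y3. a - 1 \<le> x3 \<and> 3 \<le> y3 \<and> x3 + y3 = k \<and> M - 3 \<le> x3 * y3 \<and> 3 * a - M \<le> x3 * y3"
    proof (cases "y' = 2")
      case True
      then show ?thesis using xy' a1 False Ma by (intro exI[of _ "x' - 1"] exI[of _ 3]) auto
    next
      case False
      then show ?thesis using xy' \<open>a * 2 \<le> x' * y'\<close> Ma by (intro exI[of _ x'] exI[of _ y']) auto
    qed
    then obtain x3 y3 where xy3: "a - 1 \<le> x3" "3 \<le> y3" "x3 + y3 = k" "M - 3 \<le> x3 * y3"
      "3 * a - M \<le> x3 * y3" by blast
    have v1: "(a + 1, - 1, M - a - 1) \<in> hball r"
      using xy y1 Ma b0 nonneg by (intro hball_negI[of _ _ x y]) (auto simp: r algebra_simps)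
    have v2: "(a, - 1, M - a - 1) \<in> hball r"
      using xy y1 Ma b0 nonneg by (intro hball_negI[of _ _ x y]) (auto simp: r algebra_simps)
    have v3: "(a, - 2, M - 2 * a - 1) \<in> hball r"
      using xy' Ma b0 nonneg by (intro hball_negI[of _ _ x' y']) (auto simp: r algebra_simps)
    have v4: "(a - 1, - 2, M - 2 * a - 1) \<in> hball r"
      using xy' Ma b0 nonneg a1 by (intro hball_negI[of _ _ x' y']) (auto simp: r algebra_simps)
    have v5: "(a - 1, - 3, M - 3 * a) \<in> hball r"
      using xy3 Ma b0 nonneg a1 by (intro hball_negI[of _ _ x3 y3]) (auto simp: r algebra_simps)
    have v6: "(a, - 3, M - 3 * a) \<in> hball r"
      using xy' Ma b0 nonneg a1 \<open>a * 2 \<le> x' * y'\<close>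
      by (intro hball_negI[of _ _ x' "y' + 1"]) (auto simp: r algebra_simps)
    have v7: "(a, - 2, M - 2 * a) \<in> hball r"
      using xy' Ma b0 nonneg a1 by (intro hball_negI[of _ _ x' y']) (auto simp: r algebra_simps)
    show ?thesis
      using reach_chain[of "[(a + 1, 0, M), (a + 1, - 1, M - a - 1), (a, - 1, M - a - 1),
        (a, - 2, M - 2 * a - 1), (a - 1, - 2, M - 2 * a - 1), (a - 1, - 3, M - 3 * a),
        (a, - 3, M - 3 * a), (a, - 2, M - 2 * a), (a, - 1, M - a)]" adj "hball r" 8]
        v1 v2 v3 v4 v5 v6 v7 east south b0 by auto
  qed
qed

text \<open>The box of the southern neighbour has width exactly \<open>a\<close>, so the
  compensating square goes to columns \<open>a - 1\<close> and \<open>a\<close>, in rows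
  \<open>b - 2\<close> and \<open>b - 3\<close>, or as close to this as a small \<open>b\<close>
  permits.\<close>

lemma east_south_far:
  assumes b1: "b \<ge> 1"
    and east: "(a + 1, b, M) \<in> hball r" and south: "(a, b - 1, M - a) \<in> hball r"
    and q: "b \<le> q" "a + q = k - 1" "M - a \<le> a * q" "M \<le> (a + 1) * q"
  shows "reach adj (hball r) 8 (a + 1, b, M) (a, b - 1, M - a)"
proof -
  consider (b11) "b = 1" "q = 1" | (mid) "b = 1" "q \<ge> 2" | (b2) "b = 2" | (b3) "b \<ge> 3"
    using b1 q by linarith
  then show ?thesis
  proof cases
    case b11
    then have M: "M = a + 1" using big q by simp
    have k: "k = a + 2" using b11 q by simp
    have v: "(a + 1, 0, 0) \<in> hball r" "(a, 0, 0) \<in> hball r" "(a - 1, 0, 0) \<in> hball r"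
      using a1 b11 k
      by (auto simp: r intro: hball_posI[of _ _ _ "a + 1" 0] hball_posI[of _ _ _ a 0])
    have v': "(a - 1, - 1, 1 - a) \<in> hball r" "(a, - 1, 1 - a) \<in> hball r"
      using a1 b11 k by (auto simp: r intro!: hball_negI[of _ _ a 1])
    show ?thesis
      using reach_chain[of "[(a + 1, 1, a + 1), (a + 1, 0, 0), (a, 0, 0), (a - 1, 0, 0),
        (a - 1, - 1, 1 - a), (a, - 1, 1 - a), (a, 0, 1)]" adj "hball r" 8] v v' east south M b11
      by auto
  next
    case mid
    then have Ma: "M \<ge> a + 1" using big by simp
    have "a * 2 \<le> a * q" using mid nonneg by (intro mult_left_mono) auto
    then have aq: "3 * a \<le> M + a * q" using Ma by simp
    have v1: "(a + 1, 0, M - a - 1) \<in> hball r"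
      using q Ma mid nonneg
      by (intro hball_posI[of _ _ _ "a + 1" "q - 1"]) (auto simp: r algebra_simps)
    have v2: "(a, 0, M - a - 1) \<in> hball r"
      using q Ma mid nonneg by (intro hball_posI[of _ _ _ a q]) (auto simp: r algebra_simps)
    have v3: "(a, - 1, M - 2 * a - 1) \<in> hball r" "(a - 1, - 1, M - 2 * a - 1) \<in> hball r"
      "(a - 1, - 2, M - 3 * a) \<in> hball r" "(a, - 2, M - 3 * a) \<in> hball r"
      "(a, - 1, M - 2 * a) \<in> hball r"
      using q Ma mid a1 aq by (auto simp: r algebra_simps intro!: hball_negI[of _ _ a q])
    show ?thesis
      using reach_chain[of "[(a + 1, 1, M), (a + 1, 0, M - a - 1), (a, 0, M - a - 1),
        (a, - 1, M - 2 * a - 1), (a - 1, - 1, M - 2 * a - 1), (a - 1, - 2, M - 3 * a),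
        (a, - 2, M - 3 * a), (a, - 1, M - 2 * a), (a, 0, M - a)]" adj "hball r" 8]
        v1 v2 v3 east south mid by auto
  next
    case b2
    then have Ma: "M \<ge> 2 * a + 1" using big by simp
    have "a * 2 \<le> a * q" using b2 q nonneg by (intro mult_left_mono) auto
    then have aq: "4 * a \<le> M + a * q" using Ma by simp
    have v1: "(a + 1, 1, M - a - 1) \<in> hball r"
      using q Ma b2 nonneg
      by (intro hball_posI[of _ _ _ "a + 1" "q - 1"]) (auto simp: r algebra_simps)
    have v2: "(a, 1, M - a - 1) \<in> hball r"
      using q Ma b2 nonneg by (intro hball_posI[of _ _ _ a q]) (auto simp: r algebra_simps)
    have v3: "(a, 0, M - 2 * a - 1) \<in> hball r" "(a - 1, 0, M - 2 * a - 1) \<in> hball r"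
      "(a, 0, M - 2 * a) \<in> hball r"
      using q Ma b2 a1 by (auto simp: r algebra_simps intro!: hball_posI[of _ _ _ a "q - 1"])
    have v4: "(a - 1, - 1, M - 3 * a) \<in> hball r" "(a, - 1, M - 3 * a) \<in> hball r"
      using q Ma b2 a1 aq by (auto simp: r algebra_simps intro!: hball_negI[of _ _ a "q - 1"])
    show ?thesis
      using reach_chain[of "[(a + 1, 2, M), (a + 1, 1, M - a - 1), (a, 1, M - a - 1),
        (a, 0, M - 2 * a - 1), (a - 1, 0, M - 2 * a - 1), (a - 1, - 1, M - 3 * a),
        (a, - 1, M - 3 * a), (a, 0, M - 2 * a), (a, 1, M - a)]" adj "hball r" 8]
        v1 v2 v3 v4 east south b2 by auto
  next
    case b3
    have "a * 3 \<le> a * b" using b3 nonneg by (intro mult_left_mono) auto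
    then have Ma: "M \<ge> 3 * a + 1" using big by simp
    have v1: "(a + 1, b - 1, M - a - 1) \<in> hball r"
      using q Ma b3 nonneg
      by (intro hball_posI[of _ _ _ "a + 1" "q - 1"]) (auto simp: r algebra_simps)
    have v2: "(a, b - 1, M - a - 1) \<in> hball r"
      using q Ma b3 nonneg by (intro hball_posI[of _ _ _ a q]) (auto simp: r algebra_simps)
    have v3: "(a, b - 2, M - 2 * a - 1) \<in> hball r" "(a - 1, b - 2, M - 2 * a - 1) \<in> hball r"
      "(a, b - 2, M - 2 * a) \<in> hball r"
      using q Ma b3 a1 by (auto simp: r algebra_simps intro!: hball_posI[of _ _ _ a "q - 1"])
    have v4: "(a - 1, b - 3, M - 3 * a) \<in> hball r" "(a, b - 3, M - 3 * a) \<in> hball r"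
      using q Ma b3 a1 by (auto simp: r algebra_simps intro!: hball_posI[of _ _ _ a "q - 2"])
    show ?thesis
      using reach_chain[of "[(a + 1, b, M), (a + 1, b - 1, M - a - 1), (a, b - 1, M - a - 1),
        (a, b - 2, M - 2 * a - 1), (a - 1, b - 2, M - 2 * a - 1), (a - 1, b - 3, M - 3 * a),
        (a, b - 3, M - 3 * a), (a, b - 2, M - 2 * a), (a, b - 1, M - a)]" adj "hball r" 8]
        v1 v2 v3 v4 east south by auto
  qed
qed

lemma east_south:
  assumes east: "(a + 1, b, M) \<in> hball r" and south: "(a, b - 1, M - a) \<in> hball r"
  shows "reach adj (hball r) 8 (a + 1, b, M) (a, b - 1, M - a)"
proof (cases "b = 0")
  case True
  then show ?thesis using east_south_flat assms by blast
next
  case False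
  then have b1: "b \<ge> 1" using nonneg by simp
  then have ab: "a \<le> a * b" using a1 by simp
  obtain p q where pq: "a \<le> p" "b - 1 \<le> q" "p + q = k - 1" "M - a \<le> p * q"
    using southE[OF south b1] by metis
  have "p * q > 0" using pq ab big by linarith
  then have q1: "q \<ge> 1" using pq nonneg by (simp add: zero_less_mult_iff)
  consider (far) "p \<ge> a + 2" | (near) "p = a + 1" | (edge) "p = a" using pq by linarith
  then show ?thesis
  proof cases
    case far
    have v1: "(a + 1, b - 1, M - a - 1) \<in> hball r" "(a + 2, b - 1, M - a - 1) \<in> hball r"
      "(a + 1, b - 1, M - a) \<in> hball r"
      using pq far b1 nonneg big ab by (auto simp: r intro!: hball_posI[of _ _ _ p q])
    have v2: "(a + 2, b, M + 1) \<in> hball r" "(a + 1, b, M + 1) \<in> hball r"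
      using pq far b1 nonneg
      by (auto simp: r algebra_simps intro!: hball_posI[of _ _ _ p "q + 1"])
    show ?thesis
      using reach_chain[of "[(a + 1, b, M), (a + 1, b - 1, M - a - 1), (a + 2, b - 1, M - a - 1),
        (a + 2, b, M + 1), (a + 1, b, M + 1), (a + 1, b - 1, M - a), (a, b - 1, M - a)]"
        adj "hball r" 8] v1 v2 east south by auto
  next
    case near
    then show ?thesis using east_south_near[OF b1 assms, of q] q1 pq by (auto elim: reach_mono)
  next
    case edge
    have "a * (b - 1) < a * q" using pq edge big by (simp add: algebra_simps)
    then have qb: "b \<le> q" using a1 by simp
    \<comment> \<open>If \<open>q \<ge> a + 1\<close>, the box \<open>a\<close> by \<open>q\<close>
      can be traded for \<open>a + 1\<close> by \<open>q - 1\<close> without losing area.\<close>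
    show ?thesis
    proof (cases "q \<ge> a + 1")
      case True
      then have "M - a \<le> (a + 1) * (q - 1)" using pq edge a1 by (simp add: algebra_simps)
      then show ?thesis
        using east_south_near[OF b1 assms, of "q - 1"] True pq edge a1 qb by (auto elim: reach_mono)
    next
      case False
      obtain x y where xy: "a + 1 \<le> x" "b \<le> y" "x + y = k" "M \<le> x * y"
        using eastE[OF east] by metis
      have y: "y = a + 1 + q - x" using xy pq edge by simp
      \<comment> \<open>With \<open>x + y = (a + 1) + q\<close> and
        \<open>q < a + 1 \<le> x\<close>, the box \<open>x\<close> by \<open>y\<close> is the less
        balanced one, hence has no larger area.\<close>
      have "0 \<le> (x - (a + 1)) * (x - q)" using xy False by (intro mult_nonneg_nonneg) auto
      then have "x * y \<le> (a + 1) * q" unfolding y by (simp add: algebra_simps)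
      then show ?thesis using east_south_far[OF b1 assms qb] pq edge xy by simp
    qed
  qed
qed

end

section \<open>Central elements, and the joining of all pairs of neighbours\<close>

lemma axis_east_south:
  assumes "outer_vertex 0 0 M r k" and east: "(1, 0, M) \<in> hball r"
  shows "reach adj (hball r) 6 (1, 0, M) (0, - 1, M)"
proof -
  interpret outer_vertex 0 0 M r k by fact
  obtain x y where xy: "1 \<le> x" "0 \<le> y" "x + y = k" "M \<le> x * y"
    using eastE east by auto
  have "\<not> M \<le> 0" using minimal[of 0 0] xy by auto
  then have M1: "M \<ge> 1" by simp
  show ?thesis
  proof (cases "M = 1")
    case True
    have "y \<noteq> 0" using xy M1 by auto
    then have "k = 2" using minimal[of 1 1] True xy by simp
    then have r3: "r = 3" using r by simp
    have v: "(1, - 1, 0) \<in> hball r" "(0, - 1, 0) \<in> hball r" "(0, - 1, 1) \<in> hball r"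
      unfolding r3 by (rule hball_negI[of _ _ 1 1]; simp)+
    have v': "(0, 0, 0) \<in> hball r" "(- 1, 0, 0) \<in> hball r" "(- 1, - 1, 1) \<in> hball r"
      unfolding r3 by (rule hballI[of _ 1 _ 1] hballI[of _ 1 _ 0] hballI[of _ 0 _ 0]; simp)+
    show ?thesis
      using reach_chain[of "[(1, 0, 1), (1, - 1, 0), (0, - 1, 0), (0, 0, 0), (- 1, 0, 0),
        (- 1, - 1, 1), (0, - 1, 1)]" adj "hball r" 6] v v' east True by auto
  next
    case False
    have "\<exists>x y. 1 \<le> x \<and> 2 \<le> y \<and> x + y = k \<and> M \<le> x * y"
    proof (cases "y \<ge> 2")
      case True
      then show ?thesis using xy by blast
    next
      case y: False
      have "y \<noteq> 0" using xy M1 by auto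
      then have "y = 1" using y xy by simp
      then show ?thesis using xy M1 False by (intro exI[of _ y] exI[of _ x]) auto
    qed
    then obtain x y where xy: "1 \<le> x" "2 \<le> y" "x + y = k" "M \<le> x * y" by blast
    have v: "(1, - 1, M - 1) \<in> hball r" "(0, - 1, M - 1) \<in> hball r" "(0, - 2, M) \<in> hball r"
      "(0, - 1, M) \<in> hball r"
      using xy M1 by (auto simp: r intro!: hball_negI[of _ _ x y])
    have v': "(- 1, - 1, M - 1) \<in> hball r" "(- 1, - 2, M) \<in> hball r"
      using xy M1 by (auto simp: r intro!: hballI[of _ x _ y])
    show ?thesis
      using reach_chain[of "[(1, 0, M), (1, - 1, M - 1), (0, - 1, M - 1), (- 1, - 1, M - 1),
        (- 1, - 2, M), (0, - 2, M), (0, - 1, M)]" adj "hball r" 6] v v' east by auto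
  qed
qed

text \<open>\<open>refl_y\<close> after \<open>swap\<close> is the quarter turn of the plane. It
  fixes central elements and permutes their four neighbours cyclically.\<close>

lemma reach_rotate:
  assumes "reach adj (hball r) n u w"
  shows "reach adj (hball r) n (refl_y (swap u)) (refl_y (swap w))"
  using assms by (rule reach_map) (auto intro: adj_refl)

text \<open>For \<open>M > a * b\<close>, neighbours meet at the eastern one within
  \<open>8 + 6\<close> steps if it lies in the ball, and otherwise at the southern one within
  \<open>6\<close>. The constant 36 comes from central elements, where each neighbour reaches the
  southern one by at most three rotated joins of length 6.\<close>

lemma outer_convex:
  assumes oct: "octant v" and out: "v \<notin> hball r"
    and u: "adj v u" "u \<in> hball r" and w: "adj v w" "w \<in> hball r"
  shows "reach adj (hball r) 36 u w"
proof -
  obtain a b M where v: "v = (a, b, M)" by (cases v)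
  have vr: "(a, b, M) \<in> hball (r + 1)" using hball_adj u adj_sym v by blast
  then have "odd (r + a + b)" using hball_parity out v by blast
  then obtain k where "r + a + b = 2 * k + 1" by (rule oddE)
  then have r: "r = 2 * (k + 1) - 1 - a - b" by simp
  interpret outer_vertex a b M r "k + 1"
    by unfold_locales (use oct out r v in auto)
  let ?B = "hball r"
  define E W N S where "E = (a + 1, b, M)" "W = (a - 1, b, M)" "N = (a, b + 1, M + a)"
    "S = (a, b - 1, M - a)"
  note dirs = E_W_N_S_def
  have uw: "u \<in> {E, W, N, S}" "w \<in> {E, W, N, S}" using u w v dirs by auto
  note sym = reach_sym[of adj ?B, OF _ adj_sym]
  note tr = reach_trans[of adj ?B]
  consider (axis) "a = 0" | (inner) "a \<ge> 1" "M \<le> a * b" | (big) "a \<ge> 1" "M > a * b"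
    using nonneg by linarith
  then show ?thesis
  proof cases
    case inner
    have k: "k + 1 = a + b" using inner_k inner vr by blast
    have "E \<notin> ?B" unfolding dirs
      using k by (auto elim!: eastE)
    moreover have "N \<notin> ?B" unfolding dirs
      using k by (auto elim!: northE)
    moreover have WS: "reach adj ?B 6 W S" if "W \<in> ?B" "S \<in> ?B"
    proof -
      have "b \<noteq> 0"
      proof
        assume b: "b = 0"
        from that(2) show False unfolding dirs b
          by (auto elim!: hballE simp: r b) (use k b in auto)
      qed
      then show ?thesis using inner_west_south[OF k inner(1)] that nonneg dirs by auto
    qed
    ultimately have "u \<in> {W, S}" "w \<in> {W, S}" using u w uw by auto
    then consider "u = w" | "u = W" "w = S" | "u = S" "w = W" by blast
    then show ?thesis
    proof cases
      case 1
      then show ?thesis using w by (simp add: reach.refl)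
    next
      case 2
      then show ?thesis using reach_mono[OF WS, of 36] u w by simp
    next
      case 3
      then show ?thesis using reach_mono[OF sym[OF WS], of 36] u w by simp
    qed
  next
    case big
    interpret outer_vertex_big a b M r "k + 1"
      by unfold_locales (use big in auto)
    have N: "E \<in> ?B \<and> reach adj ?B 8 E N" if "N \<in> ?B"
      using north_east reach_ends(1)[OF north_east] that unfolding dirs by simp
    have W: "S \<in> ?B \<and> reach adj ?B 6 W S" if "W \<in> ?B"
      using west_south reach_ends(2)[OF west_south] that unfolding dirs by simp
    have ES: "reach adj ?B 8 E S" if "E \<in> ?B" "S \<in> ?B"
      using east_south that unfolding dirs by simp
    have E: "reach adj ?B 8 E z" if "z \<in> {E, N, S}" "E \<in> ?B" "z \<in> ?B" for z
      using that N ES by (auto intro: reach.refl)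
    have S: "reach adj ?B 6 z S" if "z \<in> {W, S}" "z \<in> ?B" for z
      using that W by (auto intro: reach.refl)
    have E': "reach adj ?B 14 E z" if "E \<in> ?B" "z \<in> {E, W, N, S}" "z \<in> ?B" for z
    proof (cases "z = W")
      case True
      then show ?thesis using tr[OF ES sym[of 6 W S]] W that by auto
    next
      case False
      then show ?thesis using reach_mono[OF E, of z 14] that by simp
    qed
    show ?thesis
    proof (cases "E \<in> ?B")
      case True
      have "reach adj ?B (14 + 14) u w"
        by (rule tr[OF sym[OF E'[OF True uw(1) u(2)]] E'[OF True uw(2) w(2)]])
      then show ?thesis by (rule reach_mono) simp
    next
      case False
      then have "u \<in> {W, S}" "w \<in> {W, S}" using N uw u w by auto
      then have "reach adj ?B (6 + 6) u w"
        by (intro tr[OF S sym[OF S]] u w)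
      then show ?thesis by (rule reach_mono) simp
    qed
  next
    case axis
    then have b: "b = 0" using oct v by auto
    have rot: "reach adj ?B 6 (1, 0, M) (0, - 1, M)" if "(1, 0, M) \<in> ?B"
      using axis_east_south[of M r "k + 1"] that outer_vertex_axioms axis b by simp
    \<comment> \<open>Rotating any one neighbour in the ball puts all four in the ball.\<close>
    have east: "(1, 0, M) \<in> ?B"
    proof -
      have "z \<in> ?B \<Longrightarrow> refl_y (swap z) \<in> ?B" for z by simp
      from this[of "(1, 0, M)"] this[of "(0, 1, M)"] this[of "(- 1, 0, M)"] this[of "(0, - 1, M)"]
      show ?thesis using u uw(1) axis b by (auto simp: dirs)
    qed
    note ES = rot[OF east]
    note NE = reach_rotate[OF ES]
    note WN = reach_rotate[OF NE]
    have "E = (1, 0, M)" "S = (0, - 1, M)" "N = (0, 1, M)" "W = (- 1, 0, M)"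
      using axis b dirs by auto
    then have *: "reach adj ?B 6 E S" "reach adj ?B 6 N E" "reach adj ?B 6 W N"
      using ES NE WN by auto
    note NS = tr[OF *(2) *(1)]
    have WS: "reach adj ?B 18 W S" using tr[OF *(3) NS] by simp
    have "reach adj ?B 18 S S" using reach_ends(2)[OF WS] by (rule reach.refl)
    then have RS: "reach adj ?B 18 z S" if "z \<in> {E, W, N, S}" for z
      using that WS reach_mono[OF NS, of 18] reach_mono[OF *(1), of 18] by auto
    have "reach adj ?B (18 + 18) u w" by (rule tr[OF RS[OF uw(1)] sym[OF RS[OF uw(2)]]])
    then show ?thesis by simp
  qed
qed

lemma hball_convex2:
  assumes "v \<notin> hball r" "adj v u" "u \<in> hball r" "adj v w" "w \<in> hball r"
  shows "reach adj (hball r) 36 u w"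
proof -
  define Q where "Q v \<longleftrightarrow> (\<forall>u w. v \<notin> hball r \<longrightarrow> adj v u \<longrightarrow> u \<in> hball r \<longrightarrow> adj v w \<longrightarrow>
    w \<in> hball r \<longrightarrow> reach adj (hball r) 36 u w)" for v
  have transfer: "Q v" if "Q (f v)" and f: "\<And>x. f (f x) = x" "\<And>x. f x \<in> hball r \<longleftrightarrow> x \<in> hball r"
    "\<And>x y. adj x y \<Longrightarrow> adj (f x) (f y)" for f v
    unfolding Q_def
  proof (intro allI impI)
    fix u w
    assume "v \<notin> hball r" "adj v u" "u \<in> hball r" "adj v w" "w \<in> hball r"
    then have "reach adj (hball r) 36 (f u) (f w)" using that unfolding Q_def by blast
    from reach_map[OF this, of f "hball r" adj] show "reach adj (hball r) 36 u w"
      using f by simp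
  qed
  have "Q v"
  proof (rule octant_cases)
    show "Q (refl_x v) \<Longrightarrow> Q v" for v by (rule transfer[of refl_x]) (auto intro: adj_refl)
    show "Q (refl_y v) \<Longrightarrow> Q v" for v by (rule transfer[of refl_y]) (auto intro: adj_refl)
    show "Q (swap v) \<Longrightarrow> Q v" for v by (rule transfer[of swap]) (auto intro: adj_refl)
    show "octant v \<Longrightarrow> Q v" for v unfolding Q_def using outer_convex by blast
  qed
  then show ?thesis using assms unfolding Q_def by blast
qed

interpretation hball: almost_convex adj "\<lambda>r. hball (int r)" 36
proof
  fix x y v u w r
  show "adj x y \<Longrightarrow> adj y x" by (rule adj_sym)
  show "(1::nat) \<le> 36" by simp
  show "hball (int r) \<subseteq> hball (int (Suc r))" by (rule hball_mono) simp
  show "x \<in> hball (int r) \<Longrightarrow> adj x y \<Longrightarrow> y \<in> hball (int (Suc r))"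
    using hball_adj[of x "int r" y] by (simp add: add.commute)
  show "v \<in> hball (int (Suc r)) \<Longrightarrow> v \<notin> hball (int r) \<Longrightarrow> adj v w \<Longrightarrow>
      w \<in> hball (int (Suc r)) \<Longrightarrow> w \<in> hball (int r)"
    using hball_bipartite[of v "int r" w] by (simp add: add.commute)
  show "v \<notin> hball (int r) \<Longrightarrow> adj v u \<Longrightarrow> adj v w \<Longrightarrow> u \<in> hball (int r) \<Longrightarrow>
      w \<in> hball (int r) \<Longrightarrow> reach adj (hball (int r)) 36 u w"
    by (rule hball_convex2)
qed

section \<open>The word metric\<close>

text \<open>This finds the last edge of a geodesic. For \<open>M > a * b\<close> a box wider than
  \<open>a\<close> lets the path end from the east, and a box of width \<open>a\<close> from the
  south. For \<open>M \<le> a * b\<close> it ends from the west or the south.\<close>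

lemma octant_descent:
  assumes oct: "octant v" and out: "v \<notin> hball r" and vr: "v \<in> hball (r + 1)" and r0: "r \<ge> 0"
  shows "\<exists>w. adj v w \<and> w \<in> hball r"
proof -
  obtain a b M where v: "v = (a, b, M)" by (cases v)
  have "odd (r + a + b)" using hball_parity out v vr by blast
  then obtain k where "r + a + b = 2 * k + 1" by (rule oddE)
  then have r: "r = 2 * (k + 1) - 1 - a - b" by simp
  interpret outer_vertex a b M r "k + 1"
    by unfold_locales (use oct out r v in auto)
  have "(a + 1, b, M) \<in> hball r \<or> (a - 1, b, M) \<in> hball r \<or> (a, b - 1, M - a) \<in> hball r"
  proof (cases "M \<le> a * b")
    case True
    have k: "k + 1 = a + b" using inner_k True vr v by blast
    \<comment> \<open>In the octant \<open>a = 0\<close> forces \<open>b = 0\<close>, hence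
      \<open>k + 1 = 0\<close> and \<open>r = -1\<close>.\<close>
    have "a \<noteq> 0"
      using k oct r0 r v by auto
    then have a1: "a \<ge> 1" using nonneg by simp
    show ?thesis
    proof (cases "M \<le> (a - 1) * b")
      case True
      then show ?thesis
        using nonneg a1 k hball_posI[of "a - 1" b M "a - 1" b r] by (simp add: r)
    next
      case False
      have b1: "b \<ge> 1" using False nonneg \<open>M \<le> a * b\<close> by (cases "b = 0") auto
      \<comment> \<open>If \<open>M < a\<close>, then \<open>a * b \<le> 2 * M < 2 * a\<close>
        forces \<open>b = 1\<close>, and \<open>a - 1 < M < a\<close> has no integer
        solution.\<close>
      have "a \<le> M"
      proof (rule ccontr)
        assume "\<not> a \<le> M"
        then have "(a - 1) * b < a" "a * b < 2 * a" using False oct v by auto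
        then have "b < 2" using a1 by (simp add: mult.commute)
        then have "b = 1" using b1 by simp
        then show False using \<open>(a - 1) * b < a\<close> False \<open>\<not> a \<le> M\<close> by simp
      qed
      then have "(a, b - 1, M - a) \<in> hball r"
        using nonneg a1 b1 k True
        by (intro hball_posI[of _ _ _ a "b - 1"]) (auto simp: r algebra_simps)
      then show ?thesis by blast
    qed
  next
    case False
    from vr[unfolded v] show ?thesis
    proof (cases rule: hballE)
      case (1 x y)
      then have le: "x + y \<le> k + 1" using nonneg r by auto
      have xy: "a \<le> x" "b \<le> y" "M \<le> x * y" using 1 nonneg by auto
      show ?thesis
      proof (cases "x = a")
        case True
        have "b \<noteq> y" using True xy False by auto
        then have yb: "y \<ge> b + 1" using xy by simp
        show ?thesis
        proof (cases "b = 0")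
          case True
          then have "(a, - 1, M - a) \<in> hball r"
            using xy le nonneg yb \<open>x = a\<close> mult_left_mono[of 1 y a]
            by (intro hball_negI[of _ _ a y]) (auto simp: r)
          then show ?thesis using True by simp
        next
          case b: False
          have "a \<le> M"
          proof (cases "a = 0")
            case False
            then have "a \<le> a * b" using b nonneg by simp
            then show ?thesis using \<open>\<not> M \<le> a * b\<close> by simp
          qed (use nonneg in simp)
          then have "(a, b - 1, M - a) \<in> hball r"
            using xy le nonneg b True yb
            by (intro hball_posI[of _ _ _ a "y - 1"]) (auto simp: r algebra_simps)
          then show ?thesis by blast
        qed
      next
        case False
        then show ?thesis
          using xy le nonneg hball_posI[of "a + 1" b M x y r] by (simp add: r)
      qed
    qed
  qed
  then show ?thesis unfolding v by auto
qed

lemma hball_descent: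
  assumes "v \<notin> hball r" "v \<in> hball (r + 1)" "r \<ge> 0"
  shows "\<exists>w. adj v w \<and> w \<in> hball r"
proof -
  define Q where "Q v \<longleftrightarrow> (v \<notin> hball r \<longrightarrow> v \<in> hball (r + 1) \<longrightarrow> (\<exists>w. adj v w \<and> w \<in> hball r))" for v
  have transfer: "Q v" if "Q (f v)" and f: "\<And>x. f (f x) = x" "\<And>x s. f x \<in> hball s \<longleftrightarrow> x \<in> hball s"
    "\<And>x y. adj x y \<Longrightarrow> adj (f x) (f y)" for f v
    using that unfolding Q_def by metis
  have "Q v"
  proof (rule octant_cases)
    show "Q (refl_x v) \<Longrightarrow> Q v" for v by (rule transfer[of refl_x]) (auto intro: adj_refl)
    show "Q (refl_y v) \<Longrightarrow> Q v" for v by (rule transfer[of refl_y]) (auto intro: adj_refl)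
    show "Q (swap v) \<Longrightarrow> Q v" for v by (rule transfer[of swap]) (auto intro: adj_refl)
    show "octant v \<Longrightarrow> Q v" for v unfolding Q_def using octant_descent assms(3) by blast
  qed
  then show ?thesis using assms unfolding Q_def by blast
qed

lemma hball_0: "hball 0 = {(0, 0, 0)}"
proof (intro subset_antisym subsetI)
  fix v assume v: "v \<in> hball 0"
  obtain a b M where abM: "v = (a, b, M)" by (cases v)
  from v[unfolded abM] show "v \<in> {(0, 0, 0)}"
  proof (cases rule: hballE)
    case (1 x y)
    then have "0 \<le> x" "0 \<le> y" "2 * (x + y) \<le> x + y"
      using abs_ge_zero[of a] abs_ge_zero[of b] by linarith+
    then have "x = 0" "y = 0" by auto
    then show ?thesis using 1 abM by simp
  qed
qed (auto intro: hballI[of 0 0 0 0])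

text \<open>The exact isoperimetric inequality: descent to a smaller ball builds a path, and
  one-step growth of the balls bounds what a path can reach.\<close>

lemma hball_eq_reach: "v \<in> hball (int n) \<longleftrightarrow> reach adj UNIV n (0, 0, 0) v"
proof
  show "v \<in> hball (int n) \<Longrightarrow> reach adj UNIV n (0, 0, 0) v"
  proof (induction n arbitrary: v)
    case 0
    then show ?case using hball_0 by (auto intro: reach.refl)
  next
    case (Suc n)
    show ?case
    proof (cases "v \<in> hball (int n)")
      case True
      then show ?thesis using reach_mono[OF Suc.IH] by simp
    next
      case False
      then obtain w where w: "adj v w" "w \<in> hball (int n)"
        using hball_descent[of v "int n"] Suc.prems by (auto simp: add.commute)
      have "reach adj UNIV 1 w v" using adj_sym[OF w(1)] by (auto intro!: reach.intros)
      then show ?thesis using reach_trans[OF Suc.IH[OF w(2)], of 1 v] by simp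
    qed
  qed
  assume "reach adj UNIV n (0, 0, 0) v"
  then have "reach adj (hball (int (0 + n))) n (0, 0, 0) v"
    by (rule hball.A_reach) (simp add: hball_0)
  then show "v \<in> hball (int n)" using reach_ends by simp
qed

section \<open>Transfer to words in the group\<close>

fun emb :: "int \<times> int \<times> int \<Rightarrow> int \<times> int \<times> int" where
  "emb (a, b, M) = (a, b, 2 * M - a * b)"

fun hmul :: "int \<times> int \<times> int \<Rightarrow> int \<times> int \<times> int \<Rightarrow> int \<times> int \<times> int" where
  "hmul (a, b, M) (a', b', M') = (a + a', b + b', M + M' + a * b')"

fun hinv :: "int \<times> int \<times> int \<Rightarrow> int \<times> int \<times> int" where
  "hinv (a, b, M) = (- a, - b, a * b - M)"

lemma hmul_hinv [simp]: "hmul u (hmul (hinv u) v) = v" "hmul (hinv u) (hmul u v) = v"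
  by (cases u; cases v; simp add: algebra_simps)+

lemma adj_hmul: "adj v w \<Longrightarrow> adj (hmul u v) (hmul u w)"
  by (cases u; cases v) (auto simp: algebra_simps)

lemma emb_carrier [simp]: "emb v \<in> carrier heisenberg"
  by (cases v) (auto simp: heisenberg_def)

lemma emb_inject [simp]: "emb u = emb v \<longleftrightarrow> u = v"
  by (cases u; cases v) auto

lemma carrier_eq_emb: "carrier heisenberg = range emb"
proof (intro subset_antisym subsetI)
  fix g assume g: "g \<in> carrier heisenberg"
  obtain a b c where abc: "g = (a, b, c)" by (cases g)
  then have "even (c + a * b)" using g by (auto simp: heisenberg_def)
  then have "g = emb (a, b, (c + a * b) div 2)" using abc by simp
  then show "g \<in> range emb" by blast
qed (auto simp del: emb.simps)

lemma emb_hmul: "emb (hmul u v) = emb u \<otimes>\<^bsub>heisenberg\<^esub> emb v"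
  by (cases u; cases v) (simp add: heisenberg_def algebra_simps)

lemma emb_hinv: "emb (hinv u) = inv\<^bsub>heisenberg\<^esub> emb u"
proof -
  obtain a b M where u: "u = (a, b, M)" by (cases u)
  have "(a, b, 2 * M - a * b) \<in> carrier heisenberg" using emb_carrier[of u] u by simp
  from inv_heisenberg[OF this] show ?thesis unfolding u by (simp add: algebra_simps)
qed

lemma adj_gens:
  assumes "adj u w"
  shows "\<exists>s\<in>heisenberg_gens. emb w = emb u \<otimes>\<^bsub>heisenberg\<^esub> s"
  using assms by (cases u) (auto simp: heisenberg_gens_def heisenberg_def algebra_simps)

lemma gens_adj:
  assumes "s \<in> heisenberg_gens"
  shows "\<exists>w. emb w = emb u \<otimes>\<^bsub>heisenberg\<^esub> s \<and> (w = u \<or> adj u w)"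
proof -
  have "s \<in> carrier heisenberg" using assms heisenberg_gens_subset by blast
  then obtain v where "s = emb v" using carrier_eq_emb by blast
  then have "emb (hmul u v) = emb u \<otimes>\<^bsub>heisenberg\<^esub> s" using emb_hmul by simp
  moreover have "hmul u v = u \<or> adj u (hmul u v)"
    using assms \<open>s = emb v\<close> by (cases v; cases u) (auto simp: heisenberg_gens_def)
  ultimately show ?thesis by blast
qed

interpretation heis: group heisenberg by (rule group_heisenberg)

lemma word_carrier:
  "set xs \<subseteq> heisenberg_gens \<Longrightarrow>
    foldr (\<otimes>\<^bsub>heisenberg\<^esub>) xs \<one>\<^bsub>heisenberg\<^esub> \<in> carrier heisenberg"
  by (induction xs) (use heisenberg_gens_subset in auto)

lemma reach_iff_word:
  "reach adj UNIV n u w \<longleftrightarrow> (\<exists>xs. length xs \<le> n \<and> set xs \<subseteq> heisenberg_gens \<and>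
     emb w = emb u \<otimes>\<^bsub>heisenberg\<^esub> foldr (\<otimes>\<^bsub>heisenberg\<^esub>) xs \<one>\<^bsub>heisenberg\<^esub>)"
proof
  assume "reach adj UNIV n u w"
  then show "\<exists>xs. length xs \<le> n \<and> set xs \<subseteq> heisenberg_gens \<and>
     emb w = emb u \<otimes>\<^bsub>heisenberg\<^esub> foldr (\<otimes>\<^bsub>heisenberg\<^esub>) xs \<one>\<^bsub>heisenberg\<^esub>"
  proof (induction rule: reach.induct)
    case (refl u n)
    then show ?case by (intro exI[of _ "[]"]) simp
  next
    case (step u z n w)
    then obtain xs where xs: "length xs \<le> n" "set xs \<subseteq> heisenberg_gens"
      "emb w = emb z \<otimes>\<^bsub>heisenberg\<^esub> foldr (\<otimes>\<^bsub>heisenberg\<^esub>) xs \<one>\<^bsub>heisenberg\<^esub>" by blast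
    obtain s where s: "s \<in> heisenberg_gens" "emb z = emb u \<otimes>\<^bsub>heisenberg\<^esub> s"
      using adj_gens step by blast
    have "s \<in> carrier heisenberg" using s heisenberg_gens_subset by blast
    then show ?case
      using xs s word_carrier[OF xs(2)] by (intro exI[of _ "s # xs"]) (simp add: heis.m_assoc)
  qed
next
  assume "\<exists>xs. length xs \<le> n \<and> set xs \<subseteq> heisenberg_gens \<and>
     emb w = emb u \<otimes>\<^bsub>heisenberg\<^esub> foldr (\<otimes>\<^bsub>heisenberg\<^esub>) xs \<one>\<^bsub>heisenberg\<^esub>"
  then obtain xs where "length xs \<le> n" "set xs \<subseteq> heisenberg_gens"
    "emb w = emb u \<otimes>\<^bsub>heisenberg\<^esub> foldr (\<otimes>\<^bsub>heisenberg\<^esub>) xs \<one>\<^bsub>heisenberg\<^esub>" by blast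
  then show "reach adj UNIV n u w"
  proof (induction xs arbitrary: u n)
    case Nil
    then show ?case by (auto intro: reach.refl)
  next
    case (Cons s xs)
    obtain z where z: "emb z = emb u \<otimes>\<^bsub>heisenberg\<^esub> s" "z = u \<or> adj u z"
      using gens_adj Cons.prems by (meson list.set_intros(1) subsetD)
    obtain m where m: "n = Suc m" using Cons.prems by (cases n) auto
    have "s \<in> carrier heisenberg" using Cons.prems heisenberg_gens_subset by auto
    then have "emb w = emb z \<otimes>\<^bsub>heisenberg\<^esub> foldr (\<otimes>\<^bsub>heisenberg\<^esub>) xs \<one>\<^bsub>heisenberg\<^esub>"
      using z Cons.prems word_carrier[of xs] by (simp add: heis.m_assoc)
    then have "reach adj UNIV m z w" using Cons m by auto
    then show ?case using z(2) m reach_mono[of adj UNIV m z w n] by (auto intro: reach.step)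
  qed
qed

lemma word_length_le_iff:
  "word_length heisenberg heisenberg_gens (emb v) \<le> n \<longleftrightarrow> v \<in> hball (int n)"
proof -
  let ?P = "\<lambda>l. \<exists>xs. length xs = l \<and> set xs \<subseteq> heisenberg_gens \<and>
    foldr (\<otimes>\<^bsub>heisenberg\<^esub>) xs \<one>\<^bsub>heisenberg\<^esub> = emb v"
  have one: "emb (0, 0, 0) = \<one>\<^bsub>heisenberg\<^esub>" by (simp add: heisenberg_def)
  have "(\<exists>l\<le>n. ?P l) \<longleftrightarrow> reach adj UNIV n (0, 0, 0) v"
    unfolding reach_iff_word one using word_carrier by (metis heis.l_one)
  moreover have "\<exists>l. ?P l" using heisenberg_gens_generate[of "emb v"] by simp
  then have "(\<exists>l\<le>n. ?P l) \<longleftrightarrow> (LEAST l. ?P l) \<le> n"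
    using Least_le[of ?P] LeastI_ex[of ?P] order_trans by blast
  ultimately show ?thesis unfolding word_length_def hball_eq_reach by blast
qed

lemma word_ball_iff:
  "emb v \<in> word_ball heisenberg heisenberg_gens n (emb g) \<longleftrightarrow> hmul (hinv g) v \<in> hball (int n)"
  by (simp add: word_ball_def word_dist_def flip: emb_hinv emb_hmul word_length_le_iff)

text \<open>Edges are right multiplications, so left translation moves the ball to the origin and
  the bound is independent of the centre as well as of the radius.\<close>

lemma word_ball_connected:
  fixes n g
  defines "B \<equiv> {v. emb v \<in> word_ball heisenberg heisenberg_gens n (emb g)}"
  assumes "reach adj UNIV d u w" "u \<in> B" "w \<in> B"
  shows "reach adj B (36 ^ d * d) u w"
proof -
  have "reach adj UNIV d (hmul (hinv g) u) (hmul (hinv g) w)"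
    using assms(2) by (rule reach_map) (auto intro: adj_hmul)
  then have "reach adj (hball (int n)) (36 ^ d * d) (hmul (hinv g) u) (hmul (hinv g) w)"
    by (rule hball.uniformly_connected) (use assms(3,4) in \<open>auto simp: B_def word_ball_iff\<close>)
  from reach_map[OF this, of "hmul g" B adj] show ?thesis
    by (simp add: B_def word_ball_iff adj_hmul)
qed

section \<open>Passage to the limit\<close>

lemma reach_word: "\<exists>d. reach adj UNIV d u w"
proof -
  obtain xs where "set xs \<subseteq> heisenberg_gens"
    "foldr (\<otimes>\<^bsub>heisenberg\<^esub>) xs \<one>\<^bsub>heisenberg\<^esub> = emb (hmul (hinv u) w)"
    using heisenberg_gens_generate[OF emb_carrier] by blast
  then have "reach adj UNIV (length xs) u w"
    unfolding reach_iff_word by (intro exI[of _ xs]) (simp flip: emb_hmul)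
  then show ?thesis by blast
qed

lemma reach_sequence:
  assumes "reach R A n u w"
  shows "\<exists>k p. p 0 = u \<and> p k = w \<and> (\<forall>i\<le>k. p i \<in> A) \<and> (\<forall>i<k. R (p i) (p (Suc i)))"
  using assms
proof (induction rule: reach.induct)
  case (refl u n)
  then show ?case by (intro exI[of _ 0] exI[of _ "\<lambda>_. u"]) auto
next
  case (step u z n w)
  then obtain k p where "p 0 = z" "p k = w" "\<forall>i\<le>k. p i \<in> A" "\<forall>i<k. R (p i) (p (Suc i))" by blast
  then show ?case using step(1,2)
    by (intro exI[of _ "Suc k"] exI[of _ "case_nat u p"]) (auto split: nat.split)
qed

theorem theorem4:
  fixes P :: "(int \<times> int \<times> int) set"
  assumes "horoball heisenberg heisenberg_gens P"
  shows "gen_connected heisenberg heisenberg_gens P"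
  unfolding gen_connected_def
proof (intro ballI)
  fix h h' assume "h \<in> P" "h' \<in> P"
  from assms obtain g n where P: "P \<subseteq> carrier heisenberg" and g: "\<And>i. g i \<in> carrier heisenberg"
    and lim: "subset_converges heisenberg
      (\<lambda>i. word_ball heisenberg heisenberg_gens (n i) (g i :: int \<times> int \<times> int)) P"
    unfolding horoball_def by blast
  obtain u w where u: "h = emb u" and w: "h' = emb w"
    using \<open>h \<in> P\<close> \<open>h' \<in> P\<close> P carrier_eq_emb by (metis imageE subsetD)
  obtain d where d: "reach adj UNIV d u w" using reach_word by blast
  define D where "D = 36 ^ d * d"
  \<comment> \<open>\<open>D\<close> depends only on \<open>d\<close>, so this finite set is fixed
    before an index \<open>i\<close> is chosen at which ball and limit agree on it.\<close>
  define F where "F = insert u (insert w {x. reach adj UNIV D u x})"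
  have "finite {y. adj x y}" for x by (cases x) auto
  then have "finite F" unfolding F_def using finite_reach[of adj D u] by simp
  then have "\<forall>\<^sub>F i in sequentially. \<forall>x\<in>F.
      emb x \<in> word_ball heisenberg heisenberg_gens (n i) (g i) \<longleftrightarrow> emb x \<in> P"
    using lim unfolding subset_converges_def by (intro eventually_ball_finite) auto
  then obtain i where i: "\<And>x. x \<in> F \<Longrightarrow>
      emb x \<in> word_ball heisenberg heisenberg_gens (n i) (g i) \<longleftrightarrow> emb x \<in> P"
    by (auto simp: eventually_sequentially)
  obtain c where c: "g i = emb c" using g carrier_eq_emb by blast
  have "reach adj {v. emb v \<in> word_ball heisenberg heisenberg_gens (n i) (emb c)} D u w"
    unfolding D_def
    by (rule word_ball_connected[OF d])
      (use i[of u] i[of w] \<open>h \<in> P\<close> \<open>h' \<in> P\<close> u w c in \<open>auto simp: F_def\<close>)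
  then have "reach adj {v. emb v \<in> P} D u w"
    by (rule reach_transfer) (use i c in \<open>auto simp: F_def\<close>)
  from reach_sequence[OF this] obtain k p where p: "p 0 = u" "p k = w" "\<And>i. i \<le> k \<Longrightarrow> emb (p i) \<in> P"
    "\<And>i. i < k \<Longrightarrow> adj (p i) (p (Suc i))" by auto
  have "emb (p (Suc i)) \<in> emb (p i) <#\<^bsub>heisenberg\<^esub> heisenberg_gens" if "i < k" for i
    using adj_gens[OF p(4)[OF that]] unfolding l_coset_def by auto
  then show "\<exists>k q. q 0 = h \<and> q k = h' \<and> (\<forall>i\<le>k. q i \<in> P) \<and>
      (\<forall>i<k. q (Suc i) \<in> q i <#\<^bsub>heisenberg\<^esub> heisenberg_gens)"
    using p u w by (intro exI[of _ k] exI[of _ "\<lambda>i. emb (p i)"]) auto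
qed

end
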